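(* For any $p\in[1,2]$, any $n\ge2$ and any origin-symmetric star-shaped body $K$ in $\mathbb R^n$ there exists a direction $\xi\in S^{n-1}$ such that $$\int_{K\cap\xi^\perp}\|x\|_p\,dx\ge c_p\,n^{1/p}\,\mathrm{Vol}_n(K),$$ where $c_p>0$ is a constant depending on $p$ only.
   Context: $\|x\|_p=\left(\sum_{i=1}^n|x_i|^p\right)^{1/p}$. $\xi^\perp$ is the hyperplane through the origin orthogonal to $\xi$, with $(n-1)$-dimensional Lebesgue measure. A star-shaped body is a compact set with non-empty interior that is star-shaped with respect to the origin. *)

theory Defs
  imports "HOL-Analysis.Analysis"
begin

text \<open>
  The dimension \<open>n\<close> is quantified inside the statement (the constant must not depend on it), so
  \<open>\<real>\<^sup>n\<close> is the library's \<^term>\<open>Euclidean_space n\<close>: the functions \<^typ>\<open>nat \<Rightarrow> real\<close> vanishing at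
  all \<open>i \<ge> n\<close>. The sphere \<open>S\<^sup>n\<^sup>-\<^sup>1\<close> is \<^term>\<open>topspace (nsphere (n - 1))\<close>.
\<close>

abbreviation Rn :: "nat \<Rightarrow> (nat \<Rightarrow> real) set"
  where "Rn n \<equiv> topspace (Euclidean_space n)"

definition inner_Rn :: "nat \<Rightarrow> (nat \<Rightarrow> real) \<Rightarrow> (nat \<Rightarrow> real) \<Rightarrow> real"
  where "inner_Rn n x y = (\<Sum>i<n. x i * y i)"

definition pnorm :: "real \<Rightarrow> nat \<Rightarrow> (nat \<Rightarrow> real) \<Rightarrow> real"
  where "pnorm p n x = (\<Sum>i<n. \<bar>x i\<bar> powr p) powr (1 / p)"

definition perp :: "nat \<Rightarrow> (nat \<Rightarrow> real) \<Rightarrow> (nat \<Rightarrow> real) set"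
  where "perp n \<xi> = {x \<in> Rn n. inner_Rn n x \<xi> = 0}"

definition lborel_Rn :: "nat \<Rightarrow> (nat \<Rightarrow> real) measure"
  where "lborel_Rn n =
    distr (\<Pi>\<^sub>M i\<in>{..<n}. lborel) borel (\<lambda>x i. if i < n then x i else 0)"

text \<open>For \<open>\<xi> \<noteq> 0\<close>, \<open>n - 1\<close> orthonormal vectors of \<open>\<xi>\<^sup>\<bottom>\<close> form a basis of it.\<close>

definition orthonormal_basis_perp ::
    "nat \<Rightarrow> (nat \<Rightarrow> real) \<Rightarrow> (nat \<Rightarrow> nat \<Rightarrow> real) \<Rightarrow> bool"
  where "orthonormal_basis_perp n \<xi> u \<longleftrightarrow>
    (\<forall>j<n - 1. u j \<in> perp n \<xi>) \<and>
    (\<forall>j<n - 1. \<forall>k<n - 1. inner_Rn n (u j) (u k) = (if j = k then 1 else 0))"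

text \<open>
  Lebesgue measure on the hyperplane \<open>\<xi>\<^sup>\<bottom>\<close>: the image of Lebesgue measure on \<open>\<real>\<^sup>n\<^sup>-\<^sup>1\<close> under the
  linear isometry given by an orthonormal basis of \<open>\<xi>\<^sup>\<bottom>\<close>. By rotation invariance of Lebesgue
  measure it does not depend on the basis; existence of a basis is
  \<open>ex_orthonormal_basis_perp\<close> below.
\<close>

definition lborel_perp :: "nat \<Rightarrow> (nat \<Rightarrow> real) \<Rightarrow> (nat \<Rightarrow> real) measure"
  where "lborel_perp n \<xi> =
    (let u = (SOME u. orthonormal_basis_perp n \<xi> u) in
      distr (\<Pi>\<^sub>M j\<in>{..<n - 1}. lborel) borel (\<lambda>t i. \<Sum>j<n - 1. t j * u j i))"

definition star_shaped_body :: "nat \<Rightarrow> (nat \<Rightarrow> real) set \<Rightarrow> bool"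
  where "star_shaped_body n K \<longleftrightarrow>
    compactin (Euclidean_space n) K \<and>
    Euclidean_space n interior_of K \<noteq> {} \<and>
    (\<forall>x\<in>K. \<forall>t\<in>{0..1}. (\<lambda>i. t * x i) \<in> K)"

definition origin_symmetric :: "(nat \<Rightarrow> real) set \<Rightarrow> bool"
  where "origin_symmetric K \<longleftrightarrow> (\<forall>x\<in>K. (\<lambda>i. - x i) \<in> K)"

lemma measurable_lborel_Rn_map:
  fixes n :: nat
  shows "(\<lambda>x i. if i < n then x i else 0) \<in> (\<Pi>\<^sub>M i\<in>{..<n}. (lborel :: real measure)) \<rightarrow>\<^sub>M borel"
proof (rule measurable_coordinatewise_then_product)
  fix i
  show "(\<lambda>x. if i < n then x i else 0) \<in> borel_measurable (\<Pi>\<^sub>M i\<in>{..<n}. (lborel :: real measure))"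
    by (cases "i < n") (auto intro: measurable_component_singleton[where M = "\<lambda>_. lborel", simplified])
qed

lemma measurable_lborel_perp_map:
  fixes u :: "nat \<Rightarrow> nat \<Rightarrow> real"
  shows "(\<lambda>t i. \<Sum>j<m. t j * u j i) \<in> (\<Pi>\<^sub>M j\<in>{..<m}. (lborel :: real measure)) \<rightarrow>\<^sub>M borel"
proof (rule measurable_coordinatewise_then_product)
  fix i
  have "(\<lambda>t. t j) \<in> borel_measurable (\<Pi>\<^sub>M j\<in>{..<m}. (lborel :: real measure))" if "j < m" for j
    using measurable_component_singleton[of j "{..<m}" "\<lambda>_. lborel :: real measure"] that by simp
  then show "(\<lambda>t. \<Sum>j<m. t j * u j i) \<in> borel_measurable (\<Pi>\<^sub>M j\<in>{..<m}. (lborel :: real measure))"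
    by (intro borel_measurable_sum borel_measurable_times) auto
qed

text \<open>The basis is the image of the first \<open>n - 1\<close> unit vectors under the Householder reflection
  exchanging the last unit vector and \<open>\<xi>\<close>.\<close>

lemma ex_orthonormal_basis_perp:
  assumes n: "n \<ge> 1" and xi: "\<xi> \<in> topspace (nsphere (n - 1))"
  shows "\<exists>u. orthonormal_basis_perp n \<xi> u"
proof -
  define m where "m = n - 1"
  have nm: "n = Suc m" using n by (simp add: m_def)
  have zero: "\<xi> i = 0" if "i \<ge> n" for i
    using xi that by (auto simp: nsphere_def topspace_Euclidean_space nm)
  have norm: "(\<Sum>i<m. \<xi> i * \<xi> i) + \<xi> m * \<xi> m = 1"
    using xi by (simp add: nsphere_def nm power2_eq_square flip: lessThan_Suc_atMost)
  define a where "a = \<xi> m"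
  define k where "k = 1 / (1 - a)"
  define v where "v i = (if i = m then a - 1 else \<xi> i)" for i
  define u where "u j i = (if i = j then 1 else 0) - k * v j * v i" for j i :: nat
  have sv: "(\<Sum>i<m. v i * v i) = 1 - a * a"
  proof -
    have "(\<Sum>i<m. v i * v i) = (\<Sum>i<m. \<xi> i * \<xi> i)" by (intro sum.cong) (auto simp: v_def)
    then show ?thesis using norm by (simp add: a_def)
  qed
  have vv: "(\<Sum>i<n. v i * v i) = 2 * (1 - a)"
    using sv by (simp add: nm v_def algebra_simps)
  have vx: "(\<Sum>i<n. v i * \<xi> i) = 1 - a"
  proof -
    have "(\<Sum>i<m. v i * \<xi> i) = (\<Sum>i<m. v i * v i)" by (intro sum.cong) (auto simp: v_def)
    then show ?thesis using sv by (simp add: nm v_def a_def algebra_simps)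
  qed
  have uin: "u j \<in> perp n \<xi>" if j: "j < m" for j
  proof -
    have "inner_Rn n (u j) \<xi> = (\<Sum>i<n. (if i = j then \<xi> i else 0)) - k * v j * (\<Sum>i<n. v i * \<xi> i)"
      unfolding inner_Rn_def u_def sum_distrib_left sum_subtractf[symmetric]
      by (intro sum.cong) (auto simp: algebra_simps)
    also have "\<dots> = \<xi> j - k * \<xi> j * (1 - a)"
      using j by (simp add: vx) (simp add: v_def nm)
    also have "\<dots> = 0"
    proof (cases "a = 1")
      case True
      then have "(\<Sum>i<m. \<xi> i * \<xi> i) = 0" using norm by (simp add: a_def)
      then have "\<xi> j * \<xi> j = 0" using j by (subst (asm) sum_nonneg_eq_0_iff) auto
      then show ?thesis by simp
    next
      case False
      then show ?thesis by (simp add: k_def)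
    qed
    finally show ?thesis
      using j by (auto simp: perp_def topspace_Euclidean_space u_def v_def zero nm)
  qed
  have uu: "inner_Rn n (u j) (u l) = (if j = l then 1 else 0)" if "j < m" "l < m" for j l
  proof -
    have "inner_Rn n (u j) (u l) =
        (\<Sum>i<n. if i = j then (if j = l then 1 else 0) else 0)
        - (\<Sum>i<n. if i = j then k * v l * v i else 0)
        - (\<Sum>i<n. if i = l then k * v j * v i else 0)
        + k * k * v j * v l * (\<Sum>i<n. v i * v i)"
      unfolding inner_Rn_def u_def sum_distrib_left sum_subtractf[symmetric] sum.distrib[symmetric]
      by (intro sum.cong) (auto simp: algebra_simps)
    also have "\<dots> = (if j = l then 1 else 0) - 2 * k * v j * v l + k * k * v j * v l * (2 * (1 - a))"
      unfolding vv using that by (simp add: nm)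
    also have "\<dots> = (if j = l then 1 else 0) - 2 * v j * v l * (k - k * (k * (1 - a)))"
      by (simp add: algebra_simps)
    also have "k - k * (k * (1 - a)) = 0"
      by (cases "a = 1") (simp_all add: k_def)
    finally show ?thesis by simp
  qed
  show ?thesis
    using uin uu unfolding orthonormal_basis_perp_def m_def by blast
qed

end

theory Submission
  imports Defs
begin

text \<open>
  Only directions in the coordinate planes are needed. Suppose that every central hyperplane section
  of \<open>K\<close> has weighted volume less than \<open>B\<close>. The function \<open>F = \<parallel>\<cdot>\<parallel>\<^sub>p 1\<^sub>K\<close> is upper semicontinuous with
  compact support, so by reverse Fatou its averages over the slabs \<open>|x\<^sub>k + \<tau> x\<^sub>l| \<le> \<epsilon>\<close> are
  asymptotically at most \<open>B\<close>. Averaging over \<open>\<tau> \<in> [-1, 1]\<close> and exchanging the integrals bounds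
  \<open>\<integral> F(x) / max(|x\<^sub>k|, |x\<^sub>l|) dx\<close> by a multiple of \<open>B\<close>. Summing over the pairs of cyclically adjacent
  coordinates, Jensen's inequality for \<open>v \<mapsto> v\<^bsup>-1/p\<^esup>\<close> bounds the sum of the reciprocal maxima from
  below by a multiple of \<open>n\<^bsup>1 + 1/p\<^esup> / \<parallel>x\<parallel>\<^sub>p\<close>, whence \<open>n\<^bsup>1/p\<^esup> Vol(K) \<le> 24 B\<close>.
\<close>

section \<open>Lebesgue measure on \<open>Rn\<close>\<close>

lemma sets_lborel_Rn [simp, measurable_cong]: "sets (lborel_Rn n) = sets borel"
  by (simp add: lborel_Rn_def)

lemma space_lborel_Rn [simp]: "space (lborel_Rn n) = UNIV"
  by (simp add: lborel_Rn_def)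

interpretation lborel_power: product_sigma_finite "\<lambda>_::nat. lborel :: real measure"
  by standard

lemma measurable_borel_funI:
  fixes f :: "'a \<Rightarrow> nat \<Rightarrow> real"
  assumes "\<And>i. (\<lambda>x. f x i) \<in> borel_measurable M"
  shows "f \<in> M \<rightarrow>\<^sub>M borel"
  using assms by (rule measurable_coordinatewise_then_product)

lemma measurable_fun_upd_borel [measurable]:
  "(\<lambda>(x, s). x(n := s)) \<in> (borel :: (nat \<Rightarrow> real) measure) \<Otimes>\<^sub>M borel \<rightarrow>\<^sub>M borel"
proof (rule measurable_borel_funI)
  fix i show "(\<lambda>z. (case z of (x, s) \<Rightarrow> x(n := s)) i)
      \<in> borel_measurable ((borel :: (nat \<Rightarrow> real) measure) \<Otimes>\<^sub>M borel)"
    using measurable_compose[OF measurable_fst measurable_product_coordinates[of i]]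
    by (cases "i = n") (simp_all add: case_prod_beta)
qed

lemma nn_integral_lborel_Rn:
  assumes "f \<in> borel_measurable borel"
  shows "(\<integral>\<^sup>+x. f x \<partial>lborel_Rn n)
    = (\<integral>\<^sup>+x. f (\<lambda>i. if i < n then x i else 0) \<partial>(\<Pi>\<^sub>M i\<in>{..<n}. lborel))"
  unfolding lborel_Rn_def using assms measurable_lborel_Rn_map
  by (subst nn_integral_distr) auto

lemma nn_integral_lborel_Rn_0:
  assumes "f \<in> borel_measurable borel"
  shows "(\<integral>\<^sup>+x. f x \<partial>lborel_Rn 0) = f (\<lambda>_. 0)"
  using assms by (simp only: nn_integral_lborel_Rn) (simp add: PiM_empty nn_integral_count_space_finite)

text \<open>Fubini for the last coordinate. Since \<open>lborel_Rn\<close> pads with zeros, raising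
  the dimension by one amounts to filling slot \<open>n\<close>, which makes induction on the
  dimension possible without changing the type of points.\<close>

lemma nn_integral_lborel_Rn_Suc:
  assumes [measurable]: "f \<in> borel_measurable borel"
  shows "(\<integral>\<^sup>+x. f x \<partial>lborel_Rn (Suc n)) = (\<integral>\<^sup>+x. (\<integral>\<^sup>+s. f (x(n := s)) \<partial>lborel) \<partial>lborel_Rn n)"
proof -
  have 1: "(\<lambda>i. if i < Suc n then (x(n := s)) i else 0) = (\<lambda>i. if i < n then x i else 0)(n := s)"
    for x :: "nat \<Rightarrow> real" and s by auto
  have 2: "(\<lambda>x. f (\<lambda>i. if i < Suc n then x i else 0)) \<in>
    borel_measurable (\<Pi>\<^sub>M i\<in>insert n {..<n}. (lborel :: real measure))"
    using measurable_compose[OF measurable_lborel_Rn_map[of "Suc n"] assms] 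
    by (simp add: lessThan_Suc)
  have 3: "(\<lambda>x. \<integral>\<^sup>+s. f (x(n := s)) \<partial>lborel) \<in> borel_measurable borel"
    by measurable
  show ?thesis
    using 2
    by (simp only: nn_integral_lborel_Rn[OF assms] nn_integral_lborel_Rn[OF 3] lessThan_Suc)
       (subst lborel_power.product_nn_integral_insert, simp_all add: 1[simplified])
qed

lemma emeasure_lborel_Rn_box:
  assumes "0 \<le> r"
  shows "emeasure (lborel_Rn n) {x. \<forall>i<n. \<bar>x i\<bar> \<le> r} = ennreal ((2 * r) ^ n)"
proof -
  have [measurable]: "{x. \<forall>i<n. \<bar>x i\<bar> \<le> r} \<in> sets (borel :: (nat \<Rightarrow> real) measure)"
    by measurable
  have "emeasure (lborel_Rn n) {x. \<forall>i<n. \<bar>x i\<bar> \<le> r}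
      = emeasure (\<Pi>\<^sub>M i\<in>{..<n}. lborel) (\<Pi>\<^sub>E i\<in>{..<n}. {-r..r})"
    unfolding lborel_Rn_def
    by (subst emeasure_distr[OF measurable_lborel_Rn_map])
       (auto intro!: arg_cong2[where f = emeasure] simp: space_PiM PiE_def Pi_def abs_le_iff)
  also have "\<dots> = ennreal ((2 * r) ^ n)"
    using assms by (subst lborel_power.emeasure_PiM) (auto simp: ennreal_power)
  finally show ?thesis .
qed

text \<open>The measure lives on all functions \<open>nat => real\<close>, so vanishing beyond the
  first \<open>n\<close> coordinates holds only almost everywhere. Identities valid on
  \<open>Rn n\<close> enter integrals through this lemma.\<close>

lemma AE_lborel_Rn: "AE x in lborel_Rn n. x \<in> Rn n"
proof -
  have "{x. \<forall>i\<ge>n. x i = 0} \<in> sets (borel :: (nat \<Rightarrow> real) measure)"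
    by measurable
  then show ?thesis
    unfolding lborel_Rn_def topspace_Euclidean_space
    by (subst AE_distr_iff[OF measurable_lborel_Rn_map]) auto
qed

lemma sigma_finite_lborel_Rn: "sigma_finite_measure (lborel_Rn n)"
proof
  define A :: "nat \<Rightarrow> (nat \<Rightarrow> real) set" where "A k = {x. \<forall>i<n. \<bar>x i\<bar> \<le> real k}" for k
  have "x \<in> (\<Union>k. A k)" for x
  proof -
    obtain k where "(\<Sum>i<n. \<bar>x i\<bar>) \<le> real k" using real_arch_simple by blast
    moreover have "\<bar>x i\<bar> \<le> (\<Sum>i<n. \<bar>x i\<bar>)" if "i < n" for i
      using that by (intro member_le_sum) auto
    ultimately show ?thesis by (auto simp: A_def intro!: exI[of _ k] intro: order_trans)
  qed
  then have "\<Union>(range A) = space (lborel_Rn n)" by auto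
  moreover have "range A \<subseteq> sets (lborel_Rn n)" by (auto simp: A_def)
  moreover have "\<forall>a\<in>range A. emeasure (lborel_Rn n) a \<noteq> \<infinity>"
    by (auto simp: A_def emeasure_lborel_Rn_box)
  ultimately show "\<exists>A. countable A \<and> A \<subseteq> sets (lborel_Rn n) \<and> \<Union>A = space (lborel_Rn n) \<and>
      (\<forall>a\<in>A. emeasure (lborel_Rn n) a \<noteq> \<infinity>)"
    by (intro exI[of _ "range A"]) auto
qed

section \<open>Invariance under translations, reflection and linear isometries\<close>

lemma measurable_affine_borel [measurable]:
  "(\<lambda>x i. v i + c * x i) \<in> (borel :: (nat \<Rightarrow> real) measure) \<rightarrow>\<^sub>M borel"
  by (intro measurable_borel_funI) measurable

text \<open>Induction on the dimension: the last coordinate is treated by the one-dimensional affine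
  substitution, whose Jacobian \<open>\<bar>c\<bar>\<close> is 1. The cases needed later are
  translations (\<open>c = 1\<close>) and a translated point reflection
  (\<open>c = -1\<close>).\<close>

lemma nn_integral_lborel_Rn_affine:
  assumes "f \<in> borel_measurable borel" and "v \<in> Rn n" and c: "\<bar>c\<bar> = 1"
  shows "(\<integral>\<^sup>+x. f (\<lambda>i. v i + c * x i) \<partial>lborel_Rn n) = (\<integral>\<^sup>+x. f x \<partial>lborel_Rn n)"
  using assms(1,2)
proof (induction n arbitrary: f v)
  case 0
  then have "f \<in> borel_measurable borel" "v = (\<lambda>_. 0)" 
    by (auto simp: topspace_Euclidean_space)
  moreover from this(1) have "(\<lambda>x. f (\<lambda>i. v i + c * x i)) \<in> borel_measurable borel"
    by measurable
  ultimately show ?case by (simp add: nn_integral_lborel_Rn_0)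
next
  case (Suc n)
  note [measurable] = Suc.prems(1)
  have meas: "(\<lambda>x. f (\<lambda>i. v i + c * x i)) \<in> borel_measurable borel"
    by measurable
  have upd: "(\<lambda>i. v i + c * (x(n := s)) i) = (\<lambda>i. (v(n := 0)) i + c * x i)(n := v n + c * s)"
    for x :: "nat \<Rightarrow> real" and s by auto
  have aff: "(\<integral>\<^sup>+s. f (y(n := v n + c * s)) \<partial>lborel) = (\<integral>\<^sup>+s. f (y(n := s)) \<partial>lborel)" for y
    using c by (subst nn_integral_real_affine[where t = "v n" and c = c and f = "\<lambda>s. f (y(n := s))"]) auto
  have "(\<integral>\<^sup>+x. f (\<lambda>i. v i + c * x i) \<partial>lborel_Rn (Suc n))
      = (\<integral>\<^sup>+x. (\<integral>\<^sup>+s. f ((\<lambda>i. (v(n := 0)) i + c * x i)(n := s)) \<partial>lborel) \<partial>lborel_Rn n)"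
    by (simp only: nn_integral_lborel_Rn_Suc[OF meas] upd aff)
  also have "\<dots> = (\<integral>\<^sup>+y. (\<integral>\<^sup>+s. f (y(n := s)) \<partial>lborel) \<partial>lborel_Rn n)"
    using Suc.prems(2) by (intro Suc.IH, measurable) (auto simp: topspace_Euclidean_space)
  also have "\<dots> = (\<integral>\<^sup>+x. f x \<partial>lborel_Rn (Suc n))"
    by (simp add: nn_integral_lborel_Rn_Suc)
  finally show ?case .
qed

text \<open>A trace argument: the squared lengths of the residuals \<open>e\<^sub>i - \<Sum>\<^sub>j u\<^sub>j(i) u\<^sub>j\<close> add up to
  \<open>n - \<Sum>\<^sub>j |u\<^sub>j|\<^sup>2 = 0\<close>.\<close>

lemma orthonormal_dual:
  fixes u :: "nat \<Rightarrow> nat \<Rightarrow> real"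
  assumes orth: "\<And>j k. j < n \<Longrightarrow> k < n \<Longrightarrow> inner_Rn n (u j) (u k) = (if j = k then 1 else 0)"
    and il: "i < n" "l < n"
  shows "(\<Sum>j<n. u j i * u j l) = (if i = l then 1 else 0)"
proof -
  define P where "P i l = (\<Sum>j<n. u j i * u j l)" for i l
  define r where "r i l = (if i = l then 1 else 0) - P i l" for i l
  \<comment> \<open>\<open>P\<close> is symmetric and idempotent, by orthonormality of the
    \<open>u j\<close>; this is a diagonal entry of \<open>P * P = P\<close>.\<close>
  have PP: "(\<Sum>l<n. (P i l)\<^sup>2) = P i i" for i
  proof -
    have "(\<Sum>l<n. (P i l)\<^sup>2) = (\<Sum>l<n. \<Sum>j<n. \<Sum>k<n. u j i * u k i * (u j l * u k l))"
      by (simp add: P_def power2_eq_square sum_product mult_ac)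
    also have "\<dots> = (\<Sum>j<n. \<Sum>k<n. u j i * u k i * inner_Rn n (u j) (u k))"
      unfolding inner_Rn_def sum_distrib_left
      by (subst sum.swap, rule sum.cong[OF refl], rule sum.swap)
    also have "\<dots> = (\<Sum>j<n. \<Sum>k<n. if j = k then u j i * u k i else 0)"
      by (intro sum.cong refl) (auto simp: orth)
    also have "\<dots> = P i i"
      by (simp add: P_def)
    finally show ?thesis .
  qed
  have rr: "(\<Sum>l<n. (r i l)\<^sup>2) = 1 - P i i" if "i < n" for i
  proof -
    have "(\<Sum>l<n. (r i l)\<^sup>2) = (\<Sum>l<n. (if i = l then 1 - 2 * P i l else 0) + (P i l)\<^sup>2)"
      by (intro sum.cong refl) (auto simp: r_def power2_eq_square algebra_simps)
    also have "\<dots> = 1 - P i i"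
      using that by (simp add: sum.distrib PP)
    finally show ?thesis .
  qed
  have "(\<Sum>i<n. P i i) = (\<Sum>j<n. inner_Rn n (u j) (u j))"
    unfolding P_def inner_Rn_def by (rule sum.swap)
  also have "\<dots> = real n" by (simp add: orth)
  finally have "(\<Sum>i<n. \<Sum>l<n. (r i l)\<^sup>2) = 0"
    by (simp add: rr sum_subtractf)
  then have "(r i l)\<^sup>2 = 0"
    using il by (simp add: sum_nonneg_eq_0_iff sum_nonneg)
  then show ?thesis by (simp add: r_def P_def)
qed

lemma measurable_linear_combination [measurable]:
  fixes u :: "nat \<Rightarrow> nat \<Rightarrow> real"
  shows "(\<lambda>t i. \<Sum>j<m. t j * u j i) \<in> (borel :: (nat \<Rightarrow> real) measure) \<rightarrow>\<^sub>M borel"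
  by (intro measurable_borel_funI borel_measurable_sum borel_measurable_times) measurable

text \<open>Both sides are multiplied by the volume of the unit ball; after Fubini the only invariances
  needed are those of Lebesgue measure under translations and of the ball under the isometry.\<close>

lemma nn_integral_lborel_Rn_orthogonal:
  fixes u :: "nat \<Rightarrow> nat \<Rightarrow> real" and f :: "(nat \<Rightarrow> real) \<Rightarrow> ennreal"
  assumes f [measurable]: "f \<in> borel_measurable borel"
    and uR: "\<And>j. j < n \<Longrightarrow> u j \<in> Rn n"
    and orth: "\<And>j k. j < n \<Longrightarrow> k < n \<Longrightarrow> inner_Rn n (u j) (u k) = (if j = k then 1 else 0)"
  shows "(\<integral>\<^sup>+x. f (\<lambda>i. \<Sum>j<n. x j * u j i) \<partial>lborel_Rn n) = (\<integral>\<^sup>+x. f x \<partial>lborel_Rn n)"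
proof -
  define T where "T x = (\<lambda>i. \<Sum>j<n. x j * u j i)" for x
  \<comment> \<open>The adjoint of \<open>T\<close>. By \<open>orthonormal_dual\<close> it is a
    right inverse of \<open>T\<close> on \<open>Rn n\<close>.\<close>
  define T' where "T' y = (\<lambda>j. if j < n then inner_Rn n y (u j) else 0)" for y
  define g :: "(nat \<Rightarrow> real) \<Rightarrow> ennreal" where "g x = indicator {x. inner_Rn n x x \<le> 1} x" for x
  have ball [measurable]: "{x. inner_Rn n x x \<le> 1} \<in> sets borel"
    unfolding inner_Rn_def by measurable
  have [measurable]: "g \<in> borel_measurable borel"
    unfolding g_def by measurable
  have T [measurable]: "T \<in> borel \<rightarrow>\<^sub>M borel"
    unfolding T_def by measurable
  define G where "G = (\<integral>\<^sup>+x. g x \<partial>lborel_Rn n)"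
  have G: "G = emeasure (lborel_Rn n) {x. inner_Rn n x x \<le> 1}"
    by (simp add: G_def g_def)
  have "G \<le> emeasure (lborel_Rn n) {x. \<forall>i<n. \<bar>x i\<bar> \<le> 1}"
    unfolding G
  proof (rule emeasure_mono)
    show "{x. inner_Rn n x x \<le> 1} \<subseteq> {x. \<forall>i<n. \<bar>x i\<bar> \<le> 1}"
    proof safe
      fix x :: "nat \<Rightarrow> real" and i assume x: "inner_Rn n x x \<le> 1" "i < n"
      have "x i * x i \<le> inner_Rn n x x"
        unfolding inner_Rn_def using x(2) by (intro member_le_sum) auto
      then show "\<bar>x i\<bar> \<le> 1"
        using x by (simp add: abs_square_le_1 power2_eq_square flip: abs_square_le_1)
    qed
  qed measurable
  then have Gfin: "G \<noteq> \<infinity>"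
    by (auto simp: emeasure_lborel_Rn_box top_unique)
  \<comment> \<open>The factor \<open>G\<close> is cancelled at the end, so it must be finite (ball
    inside a cube, above) and nonzero (cube inside the ball, here). The denominator
    \<open>n + 1\<close> also covers dimension 0.\<close>
  have "emeasure (lborel_Rn n) {x. \<forall>i<n. \<bar>x i\<bar> \<le> 1 / (real n + 1)} \<le> G"
    unfolding G
  proof (intro emeasure_mono, safe)
    fix x :: "nat \<Rightarrow> real" assume x: "\<forall>i<n. \<bar>x i\<bar> \<le> 1 / (real n + 1)"
    have "inner_Rn n x x \<le> (\<Sum>i<n. 1 / (real n + 1))"
      unfolding inner_Rn_def
    proof (rule sum_mono)
      fix i assume "i \<in> {..<n}"
      then have "\<bar>x i\<bar> * \<bar>x i\<bar> \<le> 1 / (real n + 1) * 1"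
        using x by (intro mult_mono) (auto intro: order_trans)
      then show "x i * x i \<le> 1 / (real n + 1)" by simp
    qed
    also have "\<dots> \<le> 1" by simp
    finally show "inner_Rn n x x \<le> 1" .
  qed measurable
  then have Gpos: "G \<noteq> 0"
    by (auto simp: emeasure_lborel_Rn_box)
  have T'R: "T' y \<in> Rn n" for y by (auto simp: T'_def topspace_Euclidean_space)
  have TR: "T x \<in> Rn n" for x
    using uR by (auto simp: T_def topspace_Euclidean_space)
  have TT': "T (T' y) = y" if "y \<in> Rn n" for y
  proof
    fix i
    show "T (T' y) i = y i"
    proof (cases "i < n")
      case True
      have "T (T' y) i = (\<Sum>j<n. \<Sum>l<n. y l * (u j i * u j l))"
        by (simp add: T_def T'_def inner_Rn_def sum_distrib_left mult_ac)
      also have "\<dots> = (\<Sum>l<n. y l * (\<Sum>j<n. u j i * u j l))"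
        by (subst sum.swap) (simp add: sum_distrib_left)
      also have "\<dots> = (\<Sum>l<n. if i = l then y l else 0)"
        using True by (intro sum.cong refl) (auto simp: orthonormal_dual[OF orth])
      finally show ?thesis using True by simp
    next
      case False
      then show ?thesis using TR[of "T' y"] that by (simp add: topspace_Euclidean_space)
    qed
  qed
  have Tadd: "T (\<lambda>i. a i + c * b i) = (\<lambda>i. T a i + c * T b i)" for a b c
    by (simp add: T_def sum.distrib sum_distrib_left algebra_simps)
  have gT: "g (T x) = g x" for x
  proof -
    have "inner_Rn n (T x) (T x) = (\<Sum>i<n. \<Sum>j<n. \<Sum>k<n. x j * x k * (u j i * u k i))"
      by (simp add: T_def inner_Rn_def sum_product mult_ac)
    also have "\<dots> = (\<Sum>j<n. \<Sum>k<n. x j * x k * inner_Rn n (u j) (u k))"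
      unfolding inner_Rn_def sum_distrib_left
      by (subst sum.swap, rule sum.cong[OF refl], rule sum.swap)
    also have "\<dots> = (\<Sum>j<n. \<Sum>k<n. if j = k then x j * x k else 0)"
      by (intro sum.cong refl) (auto simp: orth)
    also have "\<dots> = inner_Rn n x x" by (simp add: inner_Rn_def)
    finally show ?thesis by (simp add: g_def indicator_def)
  qed
  interpret L: sigma_finite_measure "lborel_Rn n" by (rule sigma_finite_lborel_Rn)
  interpret LL: pair_sigma_finite "lborel_Rn n" "lborel_Rn n" ..
  let ?L = "lborel_Rn n"
  have Ti: "(\<lambda>x. T x i) \<in> borel_measurable borel" for i
    using measurable_compose[OF T measurable_product_coordinates[of i]] .
  have *: "(\<lambda>z. T (fst z) i) \<in> borel_measurable (borel \<Otimes>\<^sub>M borel)"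
    "(\<lambda>z. snd z i) \<in> borel_measurable (borel \<Otimes>\<^sub>M borel)"
    for i :: nat
    using measurable_compose[OF measurable_fst Ti[of i]]
      measurable_compose[OF measurable_snd measurable_product_coordinates[of i]] by auto
  have [measurable]: "(\<lambda>z i. snd z i + 1 * T (fst z) i) \<in> (borel \<Otimes>\<^sub>M borel) \<rightarrow>\<^sub>M borel"
    "(\<lambda>z i. - T (fst z) i + 1 * snd z i) \<in> (borel \<Otimes>\<^sub>M borel) \<rightarrow>\<^sub>M borel"
    using * by (auto intro!: measurable_borel_funI borel_measurable_add borel_measurable_diff)
  have 1: "(\<lambda>(x, y). f (\<lambda>i. y i + 1 * T x i) * g y) \<in> borel_measurable (?L \<Otimes>\<^sub>M ?L)"
    unfolding case_prod_beta by measurable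
  have 2: "(\<lambda>(x, y). f y * g (\<lambda>i. - T x i + 1 * y i)) \<in> borel_measurable (?L \<Otimes>\<^sub>M ?L)"
    unfolding case_prod_beta by measurable
  have "(\<integral>\<^sup>+x. f (T x) \<partial>?L) * G = (\<integral>\<^sup>+x. (\<integral>\<^sup>+y. f (T x) * g y \<partial>?L) \<partial>?L)"
    by (simp add: G_def nn_integral_cmult nn_integral_multc)
  also have "\<dots> = (\<integral>\<^sup>+y. (\<integral>\<^sup>+x. f (T x) * g y \<partial>?L) \<partial>?L)"
    by (rule LL.Fubini') measurable
  \<comment> \<open>Translating \<open>x\<close> by \<open>T' y\<close> shifts \<open>T x\<close> by
    \<open>T (T' y) = y\<close>. The next substitution translates \<open>y\<close> by
    \<open>- T x\<close>, which moves the dependence on \<open>T\<close> from \<open>f\<close> to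
    \<open>g\<close>.\<close>
  also have "\<dots> = (\<integral>\<^sup>+y. (\<integral>\<^sup>+x. f (\<lambda>i. y i + 1 * T x i) * g y \<partial>?L) \<partial>?L)"
  proof (rule nn_integral_cong_AE)
    show "AE y in ?L. (\<integral>\<^sup>+x. f (T x) * g y \<partial>?L)
        = (\<integral>\<^sup>+x. f (\<lambda>i. y i + 1 * T x i) * g y \<partial>?L)"
      using AE_lborel_Rn
    proof eventually_elim
      case (elim y)
      show ?case
        by (subst nn_integral_lborel_Rn_affine[OF _ T'R[of y], of _ 1, symmetric])
           (simp_all only: Tadd TT'[OF elim] abs_one, measurable)
    qed
  qed
  also have "\<dots> = (\<integral>\<^sup>+x. (\<integral>\<^sup>+y. f (\<lambda>i. y i + 1 * T x i) * g y \<partial>?L) \<partial>?L)"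
    by (rule LL.Fubini'[OF 1])
  also have "\<dots> = (\<integral>\<^sup>+x. (\<integral>\<^sup>+y. f y * g (\<lambda>i. - T x i + 1 * y i) \<partial>?L) \<partial>?L)"
  proof (rule nn_integral_cong)
    fix x
    have "(\<lambda>i. - T x i) \<in> Rn n" using TR[of x] by (simp add: topspace_Euclidean_space)
    moreover have "(\<lambda>y. f (\<lambda>i. y i + 1 * T x i) * g y) \<in> borel_measurable borel"
      using measurable_affine_borel[of "T x" 1] by (simp add: add.commute)
    ultimately show "(\<integral>\<^sup>+y. f (\<lambda>i. y i + 1 * T x i) * g y \<partial>?L)
        = (\<integral>\<^sup>+y. f y * g (\<lambda>i. - T x i + 1 * y i) \<partial>?L)"
      by (subst nn_integral_lborel_Rn_affine[where c = 1 and v = "\<lambda>i. - T x i", symmetric]) simp_all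
  qed
  also have "\<dots> = (\<integral>\<^sup>+y. (\<integral>\<^sup>+x. f y * g (\<lambda>i. - T x i + 1 * y i) \<partial>?L) \<partial>?L)"
    by (rule LL.Fubini'[OF 2, symmetric])
  also have "\<dots> = (\<integral>\<^sup>+y. f y * G \<partial>?L)"
  proof (rule nn_integral_cong_AE)
    show "AE y in ?L. (\<integral>\<^sup>+x. f y * g (\<lambda>i. - T x i + 1 * y i) \<partial>?L) = f y * G"
      using AE_lborel_Rn
    proof eventually_elim
      case (elim y)
      \<comment> \<open>Here \<open>y - T x = T (T' y - x)\<close>, and the ball is invariant under
        \<open>T\<close>; the remaining map of \<open>x\<close> is a reflection followed by a
        translation.\<close>
      have "g (\<lambda>i. - T x i + 1 * y i) = g (\<lambda>i. T' y i + (-1) * x i)" for x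
        using gT[of "\<lambda>i. T' y i + (-1) * x i"] unfolding Tadd TT'[OF elim] by simp
      moreover have "(\<integral>\<^sup>+x. g (\<lambda>i. T' y i + (-1) * x i) \<partial>?L) = G"
        unfolding G_def by (rule nn_integral_lborel_Rn_affine[OF _ T'R]) simp_all
      moreover have "(\<lambda>x. g (\<lambda>i. T' y i + (-1) * x i)) \<in> borel_measurable borel"
        by measurable
      ultimately show ?case by (simp only:) (subst nn_integral_cmult, simp_all)
    qed
  qed
  also have "\<dots> = (\<integral>\<^sup>+y. f y \<partial>?L) * G"
    by (simp add: nn_integral_multc)
  finally show ?thesis
    using Gfin Gpos by (auto simp: T_def mult.commute[of _ G] ennreal_mult_cancel_left)
qed

section \<open>Hyperplane sections and slabs\<close>

lemma nsphere_iff: "\<xi> \<in> topspace (nsphere m) \<longleftrightarrow> \<xi> \<in> Rn (Suc m) \<and> inner_Rn (Suc m) \<xi> \<xi> = 1"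
  by (auto simp: nsphere_def inner_Rn_def power2_eq_square simp flip: lessThan_Suc_atMost)

lemma inner_Rn_commute: "inner_Rn n x y = inner_Rn n y x"
  by (simp add: inner_Rn_def mult.commute)

lemma inner_Rn_add_left: "inner_Rn n (\<lambda>i. x i + y i) z = inner_Rn n x z + inner_Rn n y z"
  by (simp add: inner_Rn_def sum.distrib algebra_simps)

lemma inner_Rn_scale_left: "inner_Rn n (\<lambda>i. c * x i) z = c * inner_Rn n x z"
  by (simp add: inner_Rn_def sum_distrib_left algebra_simps)

lemma inner_Rn_sum_left:
  "inner_Rn n (\<lambda>i. \<Sum>j<m. t j * u j i) z = (\<Sum>j<m. t j * inner_Rn n (u j) z)"
  unfolding inner_Rn_def sum_distrib_right sum_distrib_left mult.assoc by (rule sum.swap)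

text \<open>Appending \<xi> to an orthonormal basis of its hyperplane gives an orthonormal basis of
  the whole space. The corresponding isometry preserves Lebesgue measure, and Fubini separates the
  coordinate along \<xi>.\<close>

lemma nn_integral_slices:
  fixes f :: "(nat \<Rightarrow> real) \<Rightarrow> ennreal"
  assumes f [measurable]: "f \<in> borel_measurable borel"
    and xi: "\<xi> \<in> topspace (nsphere m)" and u: "orthonormal_basis_perp (Suc m) \<xi> u"
  shows "(\<integral>\<^sup>+x. f x \<partial>lborel_Rn (Suc m))
    = (\<integral>\<^sup>+s. (\<integral>\<^sup>+t. f (\<lambda>i. (\<Sum>j<m. t j * u j i) + s * \<xi> i) \<partial>lborel_Rn m) \<partial>lborel)"
proof -
  interpret L: sigma_finite_measure "lborel_Rn m" by (rule sigma_finite_lborel_Rn)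
  interpret LL: pair_sigma_finite "lborel_Rn m" "lborel :: real measure" ..
  define w where "w j = (if j < m then u j else \<xi>)" for j
  have meas [measurable]: "(\<lambda>(t, s). f (\<lambda>i. (\<Sum>j<m. t j * u j i) + s * \<xi> i))
      \<in> borel_measurable (borel \<Otimes>\<^sub>M borel)"
  proof -
    have "(\<lambda>z. fst z j) \<in> borel_measurable ((borel :: (nat \<Rightarrow> real) measure) \<Otimes>\<^sub>M (borel :: real measure))"
      for j :: nat
      by (rule measurable_compose[OF measurable_fst measurable_product_coordinates])
    then have "(\<lambda>z i. (\<Sum>j<m. fst z j * u j i) + snd z * \<xi> i)
        \<in> (borel :: (nat \<Rightarrow> real) measure) \<Otimes>\<^sub>M (borel :: real measure) \<rightarrow>\<^sub>M borel"
      by (intro measurable_borel_funI borel_measurable_add borel_measurable_sum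
          borel_measurable_times) auto
    then show ?thesis
      using f by (simp add: case_prod_beta)
  qed
  have "(\<integral>\<^sup>+x. f x \<partial>lborel_Rn (Suc m))
      = (\<integral>\<^sup>+x. f (\<lambda>i. \<Sum>j<Suc m. x j * w j i) \<partial>lborel_Rn (Suc m))"
  proof (rule nn_integral_lborel_Rn_orthogonal[symmetric, OF f])
    show "w j \<in> Rn (Suc m)" if "j < Suc m" for j
      using xi u by (auto simp: w_def nsphere_iff orthonormal_basis_perp_def perp_def)
    show "inner_Rn (Suc m) (w j) (w k) = (if j = k then 1 else 0)"
      if "j < Suc m" "k < Suc m" for j k
    proof -
      have "inner_Rn (Suc m) (u j) \<xi> = 0" "inner_Rn (Suc m) \<xi> (u j) = 0" if "j < m" for j
        using u that inner_Rn_commute[of "Suc m" \<xi> "u j"]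
        by (simp_all add: orthonormal_basis_perp_def perp_def)
      then show ?thesis
        using that xi u by (auto simp: w_def nsphere_iff orthonormal_basis_perp_def less_Suc_eq)
    qed
  qed
  also have "\<dots> = (\<integral>\<^sup>+t. (\<integral>\<^sup>+s. f (\<lambda>i. (\<Sum>j<m. t j * u j i) + s * \<xi> i) \<partial>lborel) \<partial>lborel_Rn m)"
    by (subst nn_integral_lborel_Rn_Suc) (simp_all add: w_def)
  also have "\<dots> = (\<integral>\<^sup>+s. (\<integral>\<^sup>+t. f (\<lambda>i. (\<Sum>j<m. t j * u j i) + s * \<xi> i) \<partial>lborel_Rn m) \<partial>lborel)"
    by (rule LL.Fubini'[symmetric]) measurable
  finally show ?thesis .
qed

text \<open>The basis chosen by \<open>SOME\<close> in \<open>lborel_perp\<close> is exposed, so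
  that \<open>nn_integral_slices\<close> can be applied with that very basis and no independence of
  the choice has to be shown.\<close>

lemma nn_integral_lborel_perp:
  assumes xi: "\<xi> \<in> topspace (nsphere m)"
  obtains u where "orthonormal_basis_perp (Suc m) \<xi> u"
    and "\<And>f :: (nat \<Rightarrow> real) \<Rightarrow> ennreal. f \<in> borel_measurable borel \<Longrightarrow>
      (\<integral>\<^sup>+x. f x \<partial>lborel_perp (Suc m) \<xi>) = (\<integral>\<^sup>+t. f (\<lambda>i. \<Sum>j<m. t j * u j i) \<partial>lborel_Rn m)"
proof
  define u where "u = (SOME u. orthonormal_basis_perp (Suc m) \<xi> u)"
  show "orthonormal_basis_perp (Suc m) \<xi> u"
    using someI_ex[OF ex_orthonormal_basis_perp[of "Suc m" \<xi>]] xi by (simp add: u_def)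
  fix f :: "(nat \<Rightarrow> real) \<Rightarrow> ennreal" assume f [measurable]: "f \<in> borel_measurable borel"
  have "(\<integral>\<^sup>+x. f x \<partial>lborel_perp (Suc m) \<xi>)
      = (\<integral>\<^sup>+t. f (\<lambda>i. \<Sum>j<m. t j * u j i) \<partial>(\<Pi>\<^sub>M j\<in>{..<m}. lborel))"
    unfolding lborel_perp_def Let_def u_def[symmetric] 
    using f measurable_lborel_perp_map[of u m] by (simp add: nn_integral_distr)
  also have "\<dots> = (\<integral>\<^sup>+t. f (\<lambda>i. \<Sum>j<m. t j * u j i) \<partial>lborel_Rn m)"
    by (subst nn_integral_lborel_Rn) (simp_all cong: sum.cong_simp)
  finally show "(\<integral>\<^sup>+x. f x \<partial>lborel_perp (Suc m) \<xi>)
      = (\<integral>\<^sup>+t. f (\<lambda>i. \<Sum>j<m. t j * u j i) \<partial>lborel_Rn m)" .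
qed

section \<open>Upper semicontinuous weights and slab averages\<close>

text \<open>Models the p-norm times the indicator of a compact set. The bounds on values and support
  supply integrable majorants for reverse Fatou; \<open>usc\<close> compares values on nearby
  hyperplanes with those on the limit hyperplane.\<close>

locale usc_bounded_support =
  fixes F :: "(nat \<Rightarrow> real) \<Rightarrow> ennreal" and m :: nat and C R :: real
  assumes F [measurable]: "F \<in> borel_measurable borel"
    and bound: "\<And>x. F x \<le> ennreal C"
    and supp: "\<And>x i. F x \<noteq> 0 \<Longrightarrow> i < Suc m \<Longrightarrow> \<bar>x i\<bar> \<le> R" and R_nonneg: "0 \<le> R"
    and usc: "\<And>X l. X \<longlonglongrightarrow> l \<Longrightarrow> limsup (\<lambda>k. F (X k)) \<le> F l"

text \<open>Without continuity of \<open>F\<close> the slab averages need not converge to the integral over the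
  hyperplane, but upper semicontinuity suffices for an asymptotic upper bound.\<close>

lemma (in usc_bounded_support) slab_bounds:
  assumes xi: "\<xi> \<in> topspace (nsphere m)" and \<sigma>: "1 \<le> \<sigma>"
  defines "S \<equiv> \<lambda>\<epsilon>. \<integral>\<^sup>+x. F x * indicator {x. \<bar>inner_Rn (Suc m) x (\<lambda>i. \<sigma> * \<xi> i)\<bar> \<le> \<epsilon>} x \<partial>lborel_Rn (Suc m)"
  shows "0 < \<epsilon> \<Longrightarrow> S \<epsilon> \<le> ennreal C * ennreal ((2 * (real (Suc m) * R)) ^ m) * ennreal (2 * \<epsilon>)"
    and "(\<integral>\<^sup>+x. F x \<partial>lborel_perp (Suc m) \<xi>) < B \<Longrightarrow>
      \<exists>\<delta>>0. \<forall>\<epsilon>. 0 < \<epsilon> \<and> \<epsilon> < \<delta> \<longrightarrow> S \<epsilon> \<le> B * ennreal (2 * \<epsilon>)"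
    and "(\<integral>\<^sup>+x. F x \<partial>lborel_perp (Suc m) \<xi>) < \<infinity>"
proof -
  obtain u where u: "orthonormal_basis_perp (Suc m) \<xi> u"
    and perp: "\<And>f :: (nat \<Rightarrow> real) \<Rightarrow> ennreal. f \<in> borel_measurable borel \<Longrightarrow>
      (\<integral>\<^sup>+x. f x \<partial>lborel_perp (Suc m) \<xi>) = (\<integral>\<^sup>+t. f (\<lambda>i. \<Sum>j<m. t j * u j i) \<partial>lborel_Rn m)"
    using nn_integral_lborel_perp[OF xi] by blast
  \<comment> \<open>Coordinates adapted to the hyperplane: \<open>t\<close> runs along it and
    \<open>s\<close> is the signed distance from it.\<close>
  define P where "P t s = (\<lambda>i. (\<Sum>j<m. t j * u j i) + s * \<xi> i)" for t :: "nat \<Rightarrow> real" and s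
  have P [measurable]: "(\<lambda>t. P t s) \<in> borel \<rightarrow>\<^sub>M borel" for s
    unfolding P_def
    by (intro measurable_borel_funI borel_measurable_add borel_measurable_sum
          borel_measurable_times) auto
  define J where "J s = (\<integral>\<^sup>+t. F (P t s) \<partial>lborel_Rn m)" for s
  \<comment> \<open>A majorant of \<open>F (P t s)\<close> independent of \<open>s\<close>. On the
    support, \<open>t j\<close> is the inner product of \<open>P t s\<close> with
    \<open>u j\<close>, a sum of \<open>Suc m\<close> terms of modulus at most
    \<open>R\<close>.\<close>
  define w :: "(nat \<Rightarrow> real) \<Rightarrow> ennreal"
    where "w = (\<lambda>t. ennreal C * indicator {t. \<forall>j<m. \<bar>t j\<bar> \<le> real (Suc m) * R} t)"
  have [measurable]: "{t. \<forall>j<m. \<bar>t j\<bar> \<le> real (Suc m) * R} \<in> sets (borel :: (nat \<Rightarrow> real) measure)"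
    by measurable
  have w [measurable]: "w \<in> borel_measurable borel"
    unfolding w_def by measurable
  have w_int: "(\<integral>\<^sup>+t. w t \<partial>lborel_Rn m) = ennreal C * ennreal ((2 * (real (Suc m) * R)) ^ m)"
    unfolding w_def using R_nonneg
    by (subst nn_integral_cmult_indicator) (simp_all add: emeasure_lborel_Rn_box del: of_nat_Suc)
  have xi1: "inner_Rn (Suc m) \<xi> \<xi> = 1" using xi by (simp add: nsphere_iff)
  have uxi: "inner_Rn (Suc m) (u j) \<xi> = 0" if "j < m" for j
    using u that by (auto simp: orthonormal_basis_perp_def perp_def)
  have uu: "inner_Rn (Suc m) (u j) (u k) = (if j = k then 1 else 0)" if "j < m" "k < m" for j k
    using u that by (auto simp: orthonormal_basis_perp_def)
  have u_le: "\<bar>u j i\<bar> \<le> 1" if "j < m" "i < Suc m" for i j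
  proof -
    have "u j i * u j i \<le> inner_Rn (Suc m) (u j) (u j)"
      unfolding inner_Rn_def using that by (intro member_le_sum) auto
    then show ?thesis using uu[of j j] that by (simp add: power2_eq_square flip: abs_square_le_1)
  qed
  have Pxi: "inner_Rn (Suc m) (P t s) \<xi> = s" for t s
    unfolding P_def by (simp add: inner_Rn_add_left inner_Rn_scale_left inner_Rn_sum_left uxi xi1)
  have Pu: "inner_Rn (Suc m) (P t s) (u j) = t j" if "j < m" for t s j
    using that uxi[of j] unfolding P_def
    by (simp add: inner_Rn_add_left inner_Rn_scale_left inner_Rn_sum_left uu
        inner_Rn_commute[of _ \<xi>] if_distrib[of "\<lambda>x. _ * x"] cong: if_cong)
  have F_le_w: "F (P t s) \<le> w t" for t s
  proof (cases "F (P t s) = 0")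
    case False
    have "\<bar>t j\<bar> \<le> real (Suc m) * R" if j: "j < m" for j
    proof -
      have "\<bar>t j\<bar> \<le> (\<Sum>i<Suc m. \<bar>P t s i * u j i\<bar>)"
        unfolding Pu[OF j, of t s, symmetric] inner_Rn_def by (rule sum_abs)
      also have "\<dots> \<le> (\<Sum>i<Suc m. R * 1)"
        unfolding abs_mult using supp[OF False] u_le[OF j] R_nonneg
        by (intro sum_mono mult_mono) auto
      finally show ?thesis by simp
    qed
    then show ?thesis using bound by (simp add: w_def)
  qed simp
  have J_le: "J s \<le> ennreal C * ennreal ((2 * (real (Suc m) * R)) ^ m)" for s
    unfolding J_def w_int[symmetric] by (intro nn_integral_mono F_le_w)
  \<comment> \<open>The normal vector has length \<sigma>, so the slab has half-width
    \<open>\<epsilon> / \<sigma>\<close>. Since \<sigma> is at least 1, this is later relaxed to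
    \<epsilon>.\<close>
  have S_eq: "S \<epsilon> = (\<integral>\<^sup>+s. J s * indicator {- (\<epsilon> / \<sigma>)..\<epsilon> / \<sigma>} s \<partial>lborel)" for \<epsilon>
  proof -
    have [measurable]: "{x. \<bar>inner_Rn (Suc m) x (\<lambda>i. \<sigma> * \<xi> i)\<bar> \<le> \<epsilon>} \<in> sets borel"
      unfolding inner_Rn_def by measurable
    have ind: "indicator {x. \<bar>inner_Rn (Suc m) x (\<lambda>i. \<sigma> * \<xi> i)\<bar> \<le> \<epsilon>} (P t s)
        = (indicator {- (\<epsilon> / \<sigma>)..\<epsilon> / \<sigma>} s :: ennreal)" for t s
    proof -
      have "inner_Rn (Suc m) (P t s) (\<lambda>i. \<sigma> * \<xi> i) = \<sigma> * s"
        using Pxi[of t s] by (simp only: inner_Rn_commute[of _ "P t s"] inner_Rn_scale_left)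
      moreover have "\<bar>\<sigma> * s\<bar> \<le> \<epsilon> \<longleftrightarrow> s \<in> {- (\<epsilon> / \<sigma>)..\<epsilon> / \<sigma>}"
        using \<sigma> by (auto simp: abs_le_iff field_simps)
      ultimately show ?thesis by (simp add: indicator_def)
    qed
    have "S \<epsilon> = (\<integral>\<^sup>+s. (\<integral>\<^sup>+t. F (P t s) * indicator {- (\<epsilon> / \<sigma>)..\<epsilon> / \<sigma>} s \<partial>lborel_Rn m) \<partial>lborel)"
      unfolding S_def by (subst nn_integral_slices[OF _ xi u]) (simp_all add: ind flip: P_def)
    then show ?thesis
      by (simp add: J_def nn_integral_multc)
  qed
  have S_le: "S \<epsilon> \<le> D * ennreal (2 * \<epsilon>)" if D: "\<And>s. \<bar>s\<bar> \<le> \<epsilon> \<Longrightarrow> J s \<le> D" and "0 < \<epsilon>" for D \<epsilon>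
  proof -
    have le: "\<epsilon> / \<sigma> \<le> \<epsilon>" using \<sigma> \<open>0 < \<epsilon>\<close> by (simp add: divide_le_eq)
    have "S \<epsilon> \<le> (\<integral>\<^sup>+s. D * indicator {- (\<epsilon> / \<sigma>)..\<epsilon> / \<sigma>} s \<partial>lborel)"
      unfolding S_eq using D le by (intro nn_integral_mono) (auto simp: indicator_def)
    also have "\<dots> = D * ennreal (2 * (\<epsilon> / \<sigma>))"
      using \<sigma> \<open>0 < \<epsilon>\<close> by (subst nn_integral_cmult_indicator) simp_all
    also have "\<dots> \<le> D * ennreal (2 * \<epsilon>)"
      using le by (intro mult_left_mono ennreal_leI) auto
    finally show ?thesis .
  qed
  show "S \<epsilon> \<le> ennreal C * ennreal ((2 * (real (Suc m) * R)) ^ m) * ennreal (2 * \<epsilon>)" if "0 < \<epsilon>"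
    using that by (intro S_le J_le)
  have "(\<integral>\<^sup>+x. F x \<partial>lborel_perp (Suc m) \<xi>) = J 0"
    by (simp add: J_def P_def perp)
  also have "\<dots> < \<infinity>"
    using J_le[of 0] by (rule order_le_less_trans) (simp add: ennreal_mult_less_top)
  finally show "(\<integral>\<^sup>+x. F x \<partial>lborel_perp (Suc m) \<xi>) < \<infinity>" .
  assume "(\<integral>\<^sup>+x. F x \<partial>lborel_perp (Suc m) \<xi>) < B"
  then have J0: "J 0 < B" by (simp add: J_def P_def perp)
  \<comment> \<open>The section function \<open>J\<close> is upper semicontinuous at 0: a sequence
    tending to 0 along which \<open>J\<close> exceeds \<open>B\<close> contradicts reverse Fatou
    with majorant \<open>w\<close>.\<close>
  have "\<exists>\<delta>>0. \<forall>s. \<bar>s\<bar> < \<delta> \<longrightarrow> J s \<le> B"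
  proof (rule ccontr)
    assume "\<not> ?thesis"
    then have "\<exists>s. \<bar>s\<bar> < 1 / real (Suc k) \<and> B < J s" for k
      by (metis not_le of_nat_0_less_iff zero_less_Suc zero_less_divide_1_iff)
    then obtain s where s: "\<And>k. \<bar>s k\<bar> < 1 / real (Suc k)" and Bs: "\<And>k. B < J (s k)" by metis
    have "s \<longlonglongrightarrow> 0"
      by (rule tendsto_rabs_zero_cancel, rule tendsto_sandwich[OF _ _ tendsto_const LIMSEQ_Suc[OF lim_1_over_n]])
         (auto simp: less_imp_le[OF s] simp del: of_nat_Suc)
    have cont: "continuous_on UNIV (P t)" for t
      unfolding P_def by (intro continuous_on_coordinatewise_then_product continuous_intros)
    have "limsup (\<lambda>k. J (s k)) \<le> (\<integral>\<^sup>+t. limsup (\<lambda>k. F (P t (s k))) \<partial>lborel_Rn m)"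
      unfolding J_def
    proof (rule nn_integral_limsup)
      show "(\<integral>\<^sup>+t. w t \<partial>lborel_Rn m) < \<infinity>"
        unfolding w_int by (simp add: ennreal_mult_less_top)
    qed (use F_le_w in auto)
    also have "\<dots> \<le> J 0"
      unfolding J_def
      using continuous_on_tendsto_compose[OF cont \<open>s \<longlonglongrightarrow> 0\<close>] by (intro nn_integral_mono usc) auto
    finally have "limsup (\<lambda>k. J (s k)) < B" using J0 by simp
    then have "eventually (\<lambda>k. J (s k) < B) sequentially" by (rule Limsup_lessD)
    then show False using Bs by (auto simp: eventually_sequentially dest: less_asym)
  qed
  then show "\<exists>\<delta>>0. \<forall>\<epsilon>. 0 < \<epsilon> \<and> \<epsilon> < \<delta> \<longrightarrow> S \<epsilon> \<le> B * ennreal (2 * \<epsilon>)"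
    by (meson S_le order_le_less_trans)
qed

section \<open>Averaging over directions in a coordinate plane\<close>

text \<open>The zero of \<open>a + \<tau> * b\<close> lies in [-1, 1]. An interval of length
  \<open>\<epsilon> / (\<bar>b\<bar> + \<epsilon>)\<close>, at most 1, laid from that zero towards
  the origin, and possibly past it, stays in [-1, 1], and on it the affine function has modulus at
  most \<epsilon>.\<close>

lemma emeasure_affine_sublevel_ge:
  fixes a b \<epsilon> :: real
  assumes ab: "\<bar>a\<bar> \<le> \<bar>b\<bar>" and \<epsilon>: "0 < \<epsilon>"
  shows "ennreal (\<epsilon> / (\<bar>b\<bar> + \<epsilon>)) \<le> emeasure lborel {\<tau> \<in> {-1..1}. \<bar>a + \<tau> * b\<bar> \<le> \<epsilon>}"
proof -
  \<comment> \<open>If \<open>b = 0\<close> then \<open>a = 0\<close> as well, and division by zero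
    gives the admissible value 0.\<close>
  define \<tau>0 where "\<tau>0 = - a / b"
  define r where "r = \<epsilon> / (\<bar>b\<bar> + \<epsilon>)"
  have \<tau>0: "\<bar>\<tau>0\<bar> \<le> 1" "a = - \<tau>0 * b"
    using ab by (auto simp: \<tau>0_def divide_le_eq_1)
  have r: "0 \<le> r" "r \<le> 1" "r * \<bar>b\<bar> \<le> \<epsilon>"
    using \<epsilon> by (auto simp: r_def field_simps)
  define I where "I = (if \<tau>0 \<le> 0 then {\<tau>0..\<tau>0 + r} else {\<tau>0 - r..\<tau>0})"
  have "ennreal r = emeasure lborel I"
    using r by (simp add: I_def)
  also have "\<dots> \<le> emeasure lborel {\<tau> \<in> {-1..1}. \<bar>a + \<tau> * b\<bar> \<le> \<epsilon>}"
  proof (rule emeasure_mono)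
    show "I \<subseteq> {\<tau> \<in> {-1..1}. \<bar>a + \<tau> * b\<bar> \<le> \<epsilon>}"
    proof
      fix \<tau> assume "\<tau> \<in> I"
      then have "\<bar>\<tau> - \<tau>0\<bar> \<le> r" "\<tau> \<in> {-1..1}"
        using \<tau>0(1) r by (auto simp: I_def split: if_splits)
      moreover have "\<bar>a + \<tau> * b\<bar> = \<bar>\<tau> - \<tau>0\<bar> * \<bar>b\<bar>"
        unfolding \<tau>0(2) abs_mult[symmetric] by (simp add: algebra_simps)
      moreover have "\<bar>\<tau> - \<tau>0\<bar> * \<bar>b\<bar> \<le> r * \<bar>b\<bar>"
        using calculation(1) by (rule mult_right_mono) simp
      ultimately show "\<tau> \<in> {\<tau> \<in> {-1..1}. \<bar>a + \<tau> * b\<bar> \<le> \<epsilon>}"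
        using r by simp
    qed
  qed measurable
  finally show ?thesis by (simp add: r_def)
qed

text \<open>After exchanging the integrals, each fixed \<tau> contributes the average over a slab
  normal to \<open>e_k + \<tau> e_l\<close>, asymptotically at most \<open>B\<close>. Reverse Fatou
  in \<tau> gives the result; the factor 2 is the length of [-1, 1].\<close>

lemma (in usc_bounded_support) limsup_plane_average_le:
  assumes slice: "\<And>\<xi>. \<xi> \<in> topspace (nsphere m) \<Longrightarrow> (\<integral>\<^sup>+x. F x \<partial>lborel_perp (Suc m) \<xi>) < B"
    and kl: "k < Suc m" "l < Suc m" "k \<noteq> l"
    and \<epsilon>: "\<And>j. 0 < \<epsilon> j" "\<epsilon> \<longlonglongrightarrow> 0"
  shows "limsup (\<lambda>j. \<integral>\<^sup>+x. F x * (ennreal (1 / (2 * \<epsilon> j)) *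
      emeasure lborel {\<tau> \<in> {-1..1}. \<bar>x k + \<tau> * x l\<bar> \<le> \<epsilon> j}) \<partial>lborel_Rn (Suc m)) \<le> 2 * B"
proof -
  interpret L: sigma_finite_measure "lborel_Rn (Suc m)" by (rule sigma_finite_lborel_Rn)
  interpret LL: pair_sigma_finite "lborel_Rn (Suc m)" "lborel :: real measure" ..
  define A where "A e = {(x :: nat \<Rightarrow> real, \<tau> :: real). \<tau> \<in> {-1..1} \<and> \<bar>x k + \<tau> * x l\<bar> \<le> e}" for e
  have A [measurable]: "A e \<in> sets (borel \<Otimes>\<^sub>M borel)" for e
  proof -
    have [measurable]: "(\<lambda>z. fst z i) \<in> borel_measurable
        ((borel :: (nat \<Rightarrow> real) measure) \<Otimes>\<^sub>M (borel :: real measure))" for i :: nat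
      by (rule measurable_compose[OF measurable_fst measurable_product_coordinates])
    have "A e = {z \<in> space (borel \<Otimes>\<^sub>M borel). snd z \<in> {-1..1} \<and> \<bar>fst z k + snd z * fst z l\<bar> \<le> e}"
      by (auto simp: A_def space_pair_measure)
    also have "\<dots> \<in> sets (borel \<Otimes>\<^sub>M borel)" by measurable
    finally show ?thesis .
  qed
  define h where "h j \<tau> = (\<integral>\<^sup>+x. F x * (ennreal (1 / (2 * \<epsilon> j)) * indicator (A (\<epsilon> j)) (x, \<tau>))
      \<partial>lborel_Rn (Suc m))" for j \<tau>
  have [measurable]: "h j \<in> borel_measurable borel" for j
    unfolding h_def by measurable
  define C' where "C' = ennreal C * ennreal ((2 * (real (Suc m) * R)) ^ m)"
  have swap: "(\<integral>\<^sup>+x. F x * (ennreal (1 / (2 * \<epsilon> j)) *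
      emeasure lborel {\<tau> \<in> {-1..1}. \<bar>x k + \<tau> * x l\<bar> \<le> \<epsilon> j}) \<partial>lborel_Rn (Suc m))
      = (\<integral>\<^sup>+\<tau>. h j \<tau> \<partial>lborel)" for j
  proof -
    have "F x * (ennreal (1 / (2 * \<epsilon> j)) * emeasure lborel {\<tau> \<in> {-1..1}. \<bar>x k + \<tau> * x l\<bar> \<le> \<epsilon> j})
        = (\<integral>\<^sup>+\<tau>. F x * (ennreal (1 / (2 * \<epsilon> j)) * indicator (A (\<epsilon> j)) (x, \<tau>)) \<partial>lborel)" for x
    proof -
      have "indicator (A (\<epsilon> j)) (x, \<tau>) = (indicator {\<tau> \<in> {-1..1}. \<bar>x k + \<tau> * x l\<bar> \<le> \<epsilon> j} \<tau> :: ennreal)" for \<tau>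
        by (simp add: A_def indicator_def)
      moreover have "{\<tau> \<in> {-1..1}. \<bar>x k + \<tau> * x l\<bar> \<le> \<epsilon> j} \<in> sets borel" by measurable
      ultimately show ?thesis by (simp add: nn_integral_cmult)
    qed
    then show ?thesis
      unfolding h_def by (simp only:) (rule LL.Fubini'[symmetric], measurable)
  qed
  have slab: "h j \<tau> \<le> C' * indicator {-1..1} \<tau>"
      "limsup (\<lambda>j. h j \<tau>) \<le> B * indicator {-1..1} \<tau>" for j \<tau>
  proof -
    \<comment> \<open>The length of \<open>e_k + \<tau> e_l\<close>, the vector called
      \<open>z\<close> below; \<open>k\<close> and \<open>l\<close> are distinct.\<close>
    define \<sigma> where "\<sigma> = sqrt (1 + \<tau>\<^sup>2)"
    define z where "z i = (if i = k then 1 else 0) + (if i = l then \<tau> else 0)" for i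
    define \<xi> where "\<xi> i = z i / \<sigma>" for i
    have \<sigma>: "1 \<le> \<sigma>" by (simp add: \<sigma>_def)
    have z: "inner_Rn (Suc m) x z = x k + \<tau> * x l" for x
    proof -
      have "inner_Rn (Suc m) x z = (\<Sum>i<Suc m. (if i = k then x i else 0) + (if i = l then \<tau> * x i else 0))"
        unfolding inner_Rn_def by (intro sum.cong) (auto simp: z_def algebra_simps)
      then show ?thesis using kl by (simp only: sum.distrib) simp
    qed
    have z\<xi>: "z = (\<lambda>i. \<sigma> * \<xi> i)" using \<sigma> by (auto simp: \<xi>_def)
    have "inner_Rn (Suc m) z z = \<sigma>\<^sup>2"
      using kl by (simp add: z z_def \<sigma>_def power2_eq_square)
    then have "inner_Rn (Suc m) \<xi> \<xi> = 1"
      using \<sigma> unfolding inner_Rn_def \<xi>_def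
      by (simp add: power2_eq_square flip: sum_divide_distrib)
    moreover have "\<xi> \<in> Rn (Suc m)"
      using kl by (auto simp: topspace_Euclidean_space \<xi>_def z_def)
    ultimately have \<xi>: "\<xi> \<in> topspace (nsphere m)" by (simp add: nsphere_iff)
    define S where "S e = (\<integral>\<^sup>+x. F x * indicator {x. \<bar>inner_Rn (Suc m) x z\<bar> \<le> e} x \<partial>lborel_Rn (Suc m))" for e
    note S = slab_bounds[OF \<xi> \<sigma>, folded z\<xi>, folded S_def C'_def]
    have hS: "h j \<tau> = S (\<epsilon> j) * ennreal (1 / (2 * \<epsilon> j)) * indicator {-1..1} \<tau>" for j
    proof -
      have [measurable]: "{x. \<bar>inner_Rn (Suc m) x z\<bar> \<le> \<epsilon> j} \<in> sets borel"
        unfolding z by measurable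
      have "h j \<tau> = (\<integral>\<^sup>+x. F x * indicator {x. \<bar>inner_Rn (Suc m) x z\<bar> \<le> \<epsilon> j} x *
          (ennreal (1 / (2 * \<epsilon> j)) * indicator {-1..1} \<tau>) \<partial>lborel_Rn (Suc m))"
        unfolding h_def by (intro nn_integral_cong) (auto simp: A_def z indicator_def)
      also have "\<dots> = S (\<epsilon> j) * (ennreal (1 / (2 * \<epsilon> j)) * indicator {-1..1} \<tau>)"
        unfolding S_def by (rule nn_integral_multc) measurable
      finally show ?thesis by (simp only: mult.assoc)
    qed
    have cancel: "D * ennreal (2 * \<epsilon> j) * ennreal (1 / (2 * \<epsilon> j)) = D" for D j
      using \<epsilon>(1)[of j] by (simp add: mult.assoc flip: ennreal_mult)
    show "h j \<tau> \<le> C' * indicator {-1..1} \<tau>"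
      using mult_right_mono[OF S(1)[OF \<epsilon>(1)[of j]], of "ennreal (1 / (2 * \<epsilon> j))"]
      unfolding hS cancel by (intro mult_right_mono) auto
    obtain \<delta> where \<delta>: "0 < \<delta>" "\<And>e. 0 < e \<Longrightarrow> e < \<delta> \<Longrightarrow> S e \<le> B * ennreal (2 * e)"
      using S(2)[OF slice[OF \<xi>]] by blast
    have "eventually (\<lambda>j. \<epsilon> j < \<delta>) sequentially"
      using \<epsilon>(2) \<delta>(1) by (rule order_tendstoD)
    then have "eventually (\<lambda>j. h j \<tau> \<le> B * indicator {-1..1} \<tau>) sequentially"
    proof eventually_elim
      case (elim j)
      show ?case
        using mult_right_mono[OF \<delta>(2)[OF \<epsilon>(1)[of j] elim], of "ennreal (1 / (2 * \<epsilon> j))"]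
        unfolding hS cancel by (intro mult_right_mono) auto
    qed
    then show "limsup (\<lambda>j. h j \<tau>) \<le> B * indicator {-1..1} \<tau>"
      by (rule Limsup_bounded)
  qed
  have "limsup (\<lambda>j. \<integral>\<^sup>+\<tau>. h j \<tau> \<partial>lborel) \<le> (\<integral>\<^sup>+\<tau>. limsup (\<lambda>j. h j \<tau>) \<partial>lborel)"
  proof (rule nn_integral_limsup)
    have "(\<integral>\<^sup>+\<tau>. C' * indicator {-1..1 :: real} \<tau> \<partial>lborel) = C' * 2"
      by (subst nn_integral_cmult_indicator) simp_all
    then show "(\<integral>\<^sup>+\<tau>. C' * indicator {-1..1 :: real} \<tau> \<partial>lborel) < \<infinity>"
      by (simp add: C'_def ennreal_mult_less_top)
  qed (use slab(1) in auto)
  also have "\<dots> \<le> (\<integral>\<^sup>+\<tau>. B * indicator {-1..1 :: real} \<tau> \<partial>lborel)"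
    by (intro nn_integral_mono slab(2))
  also have "\<dots> = 2 * B"
    by (subst nn_integral_cmult_indicator) (simp_all add: mult.commute)
  finally show ?thesis by (simp only: swap)
qed

text \<open>\<open>emeasure_affine_sublevel_ge\<close> needs the larger coordinate as the
  coefficient of \<tau>. Adding the averages for both orders of the pair serves every point, as one
  of the two orders is always suitable.\<close>

lemma (in usc_bounded_support) eventually_coordinate_pair_le:
  assumes slice: "\<And>\<xi>. \<xi> \<in> topspace (nsphere m) \<Longrightarrow> (\<integral>\<^sup>+x. F x \<partial>lborel_perp (Suc m) \<xi>) < B"
    and kl: "k < Suc m" "l < Suc m" "k \<noteq> l"
    and \<epsilon>: "\<And>j. 0 < \<epsilon> j" "\<epsilon> \<longlonglongrightarrow> 0"
    and B: "0 < B" "B < \<infinity>"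
  shows "\<forall>\<^sub>F j in sequentially.
    (\<integral>\<^sup>+x. F x * ennreal (1 / (2 * (max \<bar>x k\<bar> \<bar>x l\<bar> + \<epsilon> j))) \<partial>lborel_Rn (Suc m)) \<le> 6 * B"
proof -
  define W where "W k l j = (\<integral>\<^sup>+x. F x * (ennreal (1 / (2 * \<epsilon> j)) *
      emeasure lborel {\<tau> \<in> {-1..1}. \<bar>x k + \<tau> * x l\<bar> \<le> \<epsilon> j}) \<partial>lborel_Rn (Suc m))" for k l j
  \<comment> \<open>Room above the limsup bound \<open>2 * B\<close> turns it into an eventual bound
    \<open>3 * B\<close>; strictness needs \<open>B\<close> positive and finite. The two orders
    together give \<open>6 * B\<close>.\<close>
  have "2 * B < 3 * B"
    using B by (intro ennreal_mult_strict_right_mono) auto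
  then have W: "\<forall>\<^sub>F j in sequentially. W a b j < 3 * B" if "a < Suc m" "b < Suc m" "a \<noteq> b" for a b
    using limsup_plane_average_le[OF slice that \<epsilon>] unfolding W_def[symmetric]
    by (intro Limsup_lessD) auto
  show ?thesis
    using W[OF kl] W[OF kl(2,1) kl(3)[symmetric]]
  proof eventually_elim
    case (elim j)
    have meas: "(\<lambda>x. emeasure lborel {\<tau> \<in> {-1..1 :: real}. \<bar>x a + \<tau> * x b\<bar> \<le> \<epsilon> j}) \<in> borel_measurable borel"
      for a b :: nat
    proof -
      have [measurable]: "(\<lambda>z. fst z i) \<in> borel_measurable
          ((borel :: (nat \<Rightarrow> real) measure) \<Otimes>\<^sub>M (borel :: real measure))" for i :: nat
        by (rule measurable_compose[OF measurable_fst measurable_product_coordinates])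
      have "{z \<in> space ((borel :: (nat \<Rightarrow> real) measure) \<Otimes>\<^sub>M (lborel :: real measure)).
          snd z \<in> {-1..1} \<and> \<bar>fst z a + snd z * fst z b\<bar> \<le> \<epsilon> j} \<in> sets (borel \<Otimes>\<^sub>M lborel)"
        by measurable
      from lborel.measurable_emeasure_Pair[OF this] show ?thesis
        by (simp add: space_pair_measure vimage_def)
    qed
    have "(\<integral>\<^sup>+x. F x * ennreal (1 / (2 * (max \<bar>x k\<bar> \<bar>x l\<bar> + \<epsilon> j))) \<partial>lborel_Rn (Suc m))
      \<le> (\<integral>\<^sup>+x. F x * (ennreal (1 / (2 * \<epsilon> j)) * emeasure lborel {\<tau> \<in> {-1..1}. \<bar>x k + \<tau> * x l\<bar> \<le> \<epsilon> j})
        + F x * (ennreal (1 / (2 * \<epsilon> j)) * emeasure lborel {\<tau> \<in> {-1..1}. \<bar>x l + \<tau> * x k\<bar> \<le> \<epsilon> j})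
          \<partial>lborel_Rn (Suc m))"
    proof (rule nn_integral_mono)
      fix x :: "nat \<Rightarrow> real"
      have split: "ennreal (1 / (2 * (b + \<epsilon> j))) = ennreal (1 / (2 * \<epsilon> j)) * ennreal (\<epsilon> j / (b + \<epsilon> j))"
        if "0 \<le> b" for b
        using that \<epsilon>(1)[of j] by (simp flip: ennreal_mult)
      have "ennreal (1 / (2 * (max \<bar>x k\<bar> \<bar>x l\<bar> + \<epsilon> j)))
        \<le> ennreal (1 / (2 * \<epsilon> j)) * emeasure lborel {\<tau> \<in> {-1..1}. \<bar>x k + \<tau> * x l\<bar> \<le> \<epsilon> j}
          + ennreal (1 / (2 * \<epsilon> j)) * emeasure lborel {\<tau> \<in> {-1..1}. \<bar>x l + \<tau> * x k\<bar> \<le> \<epsilon> j}"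
      proof (cases "\<bar>x k\<bar> \<le> \<bar>x l\<bar>")
        case True
        then show ?thesis
          using emeasure_affine_sublevel_ge[OF True \<epsilon>(1)[of j]]
          unfolding max_absorb2[OF True] split[OF abs_ge_zero]
          by (intro add_increasing2 mult_left_mono) auto
      next
        case False
        then have le: "\<bar>x l\<bar> \<le> \<bar>x k\<bar>" by simp
        then show ?thesis
          using emeasure_affine_sublevel_ge[OF le \<epsilon>(1)[of j]]
          unfolding max_absorb1[OF le] split[OF abs_ge_zero]
          by (intro add_increasing mult_left_mono) auto
      qed
      then show "F x * ennreal (1 / (2 * (max \<bar>x k\<bar> \<bar>x l\<bar> + \<epsilon> j)))
        \<le> F x * (ennreal (1 / (2 * \<epsilon> j)) * emeasure lborel {\<tau> \<in> {-1..1}. \<bar>x k + \<tau> * x l\<bar> \<le> \<epsilon> j})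
        + F x * (ennreal (1 / (2 * \<epsilon> j)) * emeasure lborel {\<tau> \<in> {-1..1}. \<bar>x l + \<tau> * x k\<bar> \<le> \<epsilon> j})"
        unfolding distrib_left[symmetric] by (intro mult_left_mono) auto
    qed
    also have "\<dots> = W k l j + W l k j"
      unfolding W_def using meas by (intro nn_integral_add) auto
    also have "\<dots> \<le> 3 * B + 3 * B"
      using elim by (intro add_mono) auto
    also have "\<dots> = 6 * B"
      by (simp flip: distrib_right)
    finally show ?case .
  qed
qed

section \<open>Lower bound for sums of reciprocal maxima\<close>

text \<open>Jensen's inequality for the negative power. The tangent at the mean \<open>a\<close>
  lies below the graph, by \<open>ln x \<le> x - 1\<close> and \<open>1 + x \<le> exp x\<close>;
  summed over all entries, the linear terms cancel.\<close>

lemma sum_powr_minus_ge: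
  fixes v :: "nat \<Rightarrow> real"
  assumes v: "\<And>i. i < n \<Longrightarrow> 0 < v i" and "0 < n" and "0 \<le> r"
  shows "real n * ((\<Sum>i<n. v i) / real n) powr (- r) \<le> (\<Sum>i<n. v i powr (- r))"
proof -
  define a where "a = (\<Sum>i<n. v i) / real n"
  have a: "0 < a"
    using v \<open>0 < n\<close> by (auto simp: a_def intro!: divide_pos_pos sum_pos)
  have "a powr (- r) * (1 - r * (v i / a - 1)) \<le> v i powr (- r)" if "i < n" for i
  proof -
    have va: "0 < v i / a" using v[OF that] a by simp
    have "1 - r * (v i / a - 1) \<le> 1 + - r * ln (v i / a)"
      using mult_left_mono[OF ln_le_minus_one[OF va] \<open>0 \<le> r\<close>] by simp
    also have "\<dots> \<le> (v i / a) powr (- r)"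
      using va exp_ge_add_one_self[of "- r * ln (v i / a)"] v[OF that] a by (simp add: powr_def)
    finally have "a powr (- r) * (1 - r * (v i / a - 1)) \<le> a powr (- r) * (v i / a) powr (- r)"
      by (intro mult_left_mono) auto
    also have "\<dots> = v i powr (- r)"
      using va a v[OF that] by (simp flip: powr_mult)
    finally show ?thesis .
  qed
  then have "(\<Sum>i<n. a powr (- r) * (1 - r * (v i / a - 1))) \<le> (\<Sum>i<n. v i powr (- r))"
    by (intro sum_mono) auto
  also have "(\<Sum>i<n. a powr (- r) * (1 - r * (v i / a - 1)))
      = a powr (- r) * (real n - r * ((\<Sum>i<n. v i) / a - real n))"
    by (simp add: sum_subtractf flip: sum_distrib_left sum_divide_distrib)
  also have "(\<Sum>i<n. v i) / a = real n"
    using a \<open>0 < n\<close> by (auto simp: a_def)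
  finally show ?thesis by (simp add: a_def mult.commute)
qed

text \<open>The p-th power of a maximum is at most the sum of both p-th powers. Each index occurs in
  exactly two cyclic pairs, whence the factor 2; Jensen with exponent \<open>1 / p\<close>
  finishes.\<close>

lemma sum_cyclic_max_ge:
  fixes y :: "nat \<Rightarrow> real"
  assumes y: "\<And>i. i < Suc m \<Longrightarrow> 0 < y i" and p: "0 < p"
  shows "real (Suc m) * (2 * (\<Sum>i<Suc m. y i powr p) / real (Suc m)) powr (- (1 / p))
    \<le> (\<Sum>i<Suc m. 1 / max (y i) (y (if i = m then 0 else Suc i)))"
proof -
  define s where "s i = (if i = m then 0 else Suc i)" for i
  define v where "v i = y i powr p + y (s i) powr p" for i
  have s: "s i < Suc m" if "i < Suc m" for i using that by (auto simp: s_def)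
  have "(\<Sum>i<Suc m. y (s i) powr p) = (\<Sum>i<m. y (Suc i) powr p) + y 0 powr p"
    by (simp add: s_def)
  also have "\<dots> = (\<Sum>i<Suc m. y i powr p)"
    by (simp only: sum.lessThan_Suc_shift add.commute)
  finally have sum_v: "(\<Sum>i<Suc m. v i) = 2 * (\<Sum>i<Suc m. y i powr p)"
    by (simp only: v_def sum.distrib mult_2)
  have v: "0 < v i" if "i < Suc m" for i
    using y[OF that] y[OF s[OF that]] by (simp add: v_def add_pos_pos)
  have "v i powr (- (1 / p)) \<le> 1 / max (y i) (y (s i))" if "i < Suc m" for i
  proof -
    have pos: "0 < y i" "0 < y (s i)" using y that s by auto
    have "max (y i) (y (s i)) powr p \<le> v i"
      by (auto simp: v_def max_def)
    then have "(max (y i) (y (s i)) powr p) powr (1 / p) \<le> v i powr (1 / p)"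
      using p by (intro powr_mono2) auto
    then have "max (y i) (y (s i)) \<le> v i powr (1 / p)"
      using pos p by (simp add: powr_powr)
    then show ?thesis
      using pos le_imp_inverse_le[of "max (y i) (y (s i))" "v i powr (1 / p)"]
      by (simp add: powr_minus inverse_eq_divide less_max_iff_disj)
  qed
  then have "(\<Sum>i<Suc m. v i powr (- (1 / p))) \<le> (\<Sum>i<Suc m. 1 / max (y i) (y (s i)))"
    by (intro sum_mono) auto
  moreover have "real (Suc m) * ((\<Sum>i<Suc m. v i) / real (Suc m)) powr (- (1 / p))
      \<le> (\<Sum>i<Suc m. v i powr (- (1 / p)))"
    using v p by (intro sum_powr_minus_ge) auto
  ultimately show ?thesis
    unfolding sum_v s_def by linarith
qed

section \<open>The slicing inequality\<close>

lemma continuous_on_pnorm: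
  assumes "0 < p"
  shows "continuous_on UNIV (pnorm p n)"
  unfolding pnorm_def using assms
  by (intro continuous_on_powr' continuous_intros continuous_on_product_coordinates)
     (auto intro: sum_nonneg)

lemma pnorm_nonneg: "0 \<le> pnorm p n x"
  by (simp add: pnorm_def)

lemma perp_borel [measurable]: "perp n \<xi> \<in> sets borel"
proof -
  have "perp n \<xi> = {x. (\<forall>i\<ge>n. x i = 0) \<and> (\<Sum>i<n. x i * \<xi> i) = 0}"
    by (auto simp: perp_def inner_Rn_def topspace_Euclidean_space)
  also have "\<dots> \<in> sets borel" by measurable
  finally show ?thesis .
qed

lemma set_integral_perp_eq:
  fixes g :: "(nat \<Rightarrow> real) \<Rightarrow> real"
  assumes [measurable]: "g \<in> borel_measurable borel" "K \<in> sets borel" and g: "\<And>x. 0 \<le> g x"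
    and xi: "\<xi> \<in> topspace (nsphere m)"
  shows "(LINT x:(K \<inter> perp (Suc m) \<xi>)|lborel_perp (Suc m) \<xi>. g x)
    = enn2real (\<integral>\<^sup>+x. ennreal (g x) * indicator K x \<partial>lborel_perp (Suc m) \<xi>)"
proof -
  obtain u where u: "orthonormal_basis_perp (Suc m) \<xi> u"
    and perp: "\<And>f :: (nat \<Rightarrow> real) \<Rightarrow> ennreal. f \<in> borel_measurable borel \<Longrightarrow>
      (\<integral>\<^sup>+x. f x \<partial>lborel_perp (Suc m) \<xi>) = (\<integral>\<^sup>+t. f (\<lambda>i. \<Sum>j<m. t j * u j i) \<partial>lborel_Rn m)"
    using nn_integral_lborel_perp[OF xi] by blast
  have sets: "sets (lborel_perp (Suc m) \<xi>) = sets borel"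
    by (simp add: lborel_perp_def Let_def)
  have in_perp: "(\<lambda>i. \<Sum>j<m. t j * u j i) \<in> perp (Suc m) \<xi>" for t
    using u by (auto simp: perp_def orthonormal_basis_perp_def inner_Rn_sum_left topspace_Euclidean_space)
  have "(LINT x:(K \<inter> perp (Suc m) \<xi>)|lborel_perp (Suc m) \<xi>. g x)
    = enn2real (\<integral>\<^sup>+x. ennreal (indicator (K \<inter> perp (Suc m) \<xi>) x * g x) \<partial>lborel_perp (Suc m) \<xi>)"
    unfolding set_lebesgue_integral_def using g
    by (subst integral_eq_nn_integral) (auto cong: measurable_cong_sets[OF sets refl])
  also have "(\<integral>\<^sup>+x. ennreal (indicator (K \<inter> perp (Suc m) \<xi>) x * g x) \<partial>lborel_perp (Suc m) \<xi>)
    = (\<integral>\<^sup>+x. ennreal (g x) * indicator K x \<partial>lborel_perp (Suc m) \<xi>)"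
  proof -
    have 1: "(\<lambda>x. ennreal (indicator (K \<inter> perp (Suc m) \<xi>) x * g x)) \<in> borel_measurable borel"
      and 2: "(\<lambda>x. ennreal (g x) * indicator K x) \<in> borel_measurable borel"
      by measurable
    show ?thesis
      unfolding perp[OF 1] perp[OF 2] by (intro nn_integral_cong) (simp add: indicator_def in_perp)
  qed
  finally show ?thesis .
qed

text \<open>Ensures that the p-norm is positive almost everywhere, so that its negative powers
  behave well in the limit.\<close>

lemma AE_lborel_Rn_nonzero: "AE x in lborel_Rn (Suc m). x m \<noteq> 0"
proof -
  have [measurable]: "{x. x m = 0} \<in> sets (borel :: (nat \<Rightarrow> real) measure)" by measurable
  have "emeasure (lborel_Rn (Suc m)) {x. x m = 0}
      = (\<integral>\<^sup>+x. indicator {x. x m = 0} x \<partial>lborel_Rn (Suc m))" by simp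
  also have "\<dots> = (\<integral>\<^sup>+x. (\<integral>\<^sup>+s. indicator {0 :: real} s \<partial>lborel) \<partial>lborel_Rn m)"
  proof -
    have "indicator {x. x m = 0} (x(m := s)) = (indicator {0} s :: ennreal)"
      for x :: "nat \<Rightarrow> real" and s by (simp add: indicator_def)
    then show ?thesis by (subst nn_integral_lborel_Rn_Suc) simp_all
  qed
  also have "\<dots> = 0" by simp
  finally show ?thesis
    by (intro AE_I[of _ _ "{x. x m = 0}"]) auto
qed

text \<open>Upper semicontinuity rests on \<open>K\<close> being closed: at a limit in
  \<open>K\<close> the indicator is at most 1 and \<open>g\<close> is continuous, while a sequence
  with limit outside \<open>K\<close> eventually leaves \<open>K\<close>.\<close>

lemma usc_bounded_support_compact:
  assumes K: "compact K" and g: "continuous_on UNIV g" "\<And>x. 0 \<le> g x"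
  obtains C R where "usc_bounded_support (\<lambda>x. ennreal (g x) * indicator K x) m C R"
proof -
  have "bounded (g ` K)"
    using K g(1) by (intro compact_imp_bounded compact_continuous_image continuous_on_subset[OF g(1)]) auto
  then obtain C where C: "\<And>x. x \<in> K \<Longrightarrow> \<bar>g x\<bar> \<le> C" by (auto simp: bounded_iff)
  have cont: "continuous_on UNIV (\<lambda>x :: nat \<Rightarrow> real. \<Sum>i<Suc m. \<bar>x i\<bar>)"
    by (intro continuous_intros continuous_on_product_coordinates)
  have "bounded ((\<lambda>x. \<Sum>i<Suc m. \<bar>x i\<bar>) ` K)"
    using K by (intro compact_imp_bounded compact_continuous_image continuous_on_subset[OF cont]) auto
  then obtain R where R: "0 < R" "\<And>x. x \<in> K \<Longrightarrow> (\<Sum>i<Suc m. \<bar>x i\<bar>) \<le> R" 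
    unfolding bounded_pos by (auto simp: abs_le_iff)
  have closed: "closed K" using K by (rule compact_imp_closed)
  have [measurable]: "g \<in> borel_measurable borel" "K \<in> sets borel"
    using g(1) closed by (auto intro: borel_measurable_continuous_onI)
  show thesis
  proof (rule that[of C R], unfold_locales)
    show "(\<lambda>x. ennreal (g x) * indicator K x) \<in> borel_measurable borel" by measurable
    show "ennreal (g x) * indicator K x \<le> ennreal C" for x
      using C[of x] by (auto simp: indicator_def intro!: ennreal_leI)
    show "\<bar>x i\<bar> \<le> R" if "ennreal (g x) * indicator K x \<noteq> 0" "i < Suc m" for x i
    proof -
      have "x \<in> K" using that(1) by (auto simp: indicator_def split: if_splits)
      moreover have "\<bar>x i\<bar> \<le> (\<Sum>i<Suc m. \<bar>x i\<bar>)" using that(2) by (intro member_le_sum) auto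
      ultimately show ?thesis using R(2)[of x] by linarith
    qed
    show "0 \<le> R" using R by simp
    show "limsup (\<lambda>k. ennreal (g (X k)) * indicator K (X k)) \<le> ennreal (g l) * indicator K l"
      if X: "X \<longlonglongrightarrow> l" for X l
    proof (cases "l \<in> K")
      case True
      have "(\<lambda>k. ennreal (g (X k))) \<longlonglongrightarrow> ennreal (g l)"
        using continuous_on_tendsto_compose[OF g(1) X] by (intro tendsto_ennrealI) auto
      then have "limsup (\<lambda>k. ennreal (g (X k))) = ennreal (g l)"
        by (intro lim_imp_Limsup) auto
      moreover have "limsup (\<lambda>k. ennreal (g (X k)) * indicator K (X k)) \<le> limsup (\<lambda>k. ennreal (g (X k)))"
        by (intro Limsup_mono always_eventually) (auto simp: indicator_def)
      ultimately show ?thesis using True by simp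
    next
      case False
      have "eventually (\<lambda>k. X k \<in> - K) sequentially"
        using closed False by (intro topological_tendstoD[OF X]) auto
      then have "eventually (\<lambda>k. ennreal (g (X k)) * indicator K (X k) \<le> 0) sequentially"
        by eventually_elim auto
      from Limsup_bounded[OF this] False show ?thesis by simp
    qed
  qed
qed

lemma compactin_Euclidean_space_imp_compact:
  assumes "compactin (Euclidean_space n) K"
  shows "compact K"
  using assms
  by (simp add: Euclidean_space_def compactin_subtopology euclidean_product_topology)

lemma pnorm_slicing_inequality:
  fixes p :: real
  assumes p: "1 \<le> p" and "m \<ge> 1" and K: "compact K" "0 < measure (lborel_Rn (Suc m)) K"
  shows "\<exists>\<xi>\<in>topspace (nsphere m).
    (LINT x:(K \<inter> perp (Suc m) \<xi>)|lborel_perp (Suc m) \<xi>. pnorm p (Suc m) x)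
      \<ge> 1 / 48 * real (Suc m) powr (1 / p) * measure (lborel_Rn (Suc m)) K"
proof (rule ccontr)
  define n where "n = Suc m"
  define V where "V = measure (lborel_Rn n) K"
  \<comment> \<open>The estimates below yield \<open>n powr (1 / p) * V \<le> 24 * b\<close>, so any
    constant below 1/24 leads to a contradiction.\<close>
  define b where "b = 1 / 48 * real n powr (1 / p) * V"
  define F where "F x = ennreal (pnorm p n x) * indicator K x" for x
  define \<epsilon> where "\<epsilon> j = 1 / real (Suc j)" for j
  define s where "s i = (if i = m then 0 else Suc i)" for i
  assume "\<not> ?thesis"
  then have less: "\<And>\<xi>. \<xi> \<in> topspace (nsphere m) \<Longrightarrow>
      (LINT x:(K \<inter> perp n \<xi>)|lborel_perp n \<xi>. pnorm p n x) < b"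
    by (auto simp: not_le b_def V_def n_def)
  have V: "0 < V" "ennreal V = emeasure (lborel_Rn n) K"
  proof -
    \<comment> \<open>Positivity also rules out infinite volume, which \<open>measure\<close> would
      send to 0.\<close>
    show "0 < V" using K by (simp add: V_def n_def)
    then have "emeasure (lborel_Rn n) K \<noteq> \<infinity>"
      by (auto simp: V_def measure_def)
    then show "ennreal V = emeasure (lborel_Rn n) K"
      by (simp add: V_def emeasure_eq_ennreal_measure)
  qed
  have n: "0 < real n" by (simp add: n_def)
  have b: "0 < b" using V n by (simp add: b_def)
  have [measurable]: "pnorm p n \<in> borel_measurable borel" "K \<in> sets borel"
    using p K by (auto intro!: borel_measurable_continuous_onI continuous_on_pnorm
        borel_closed compact_imp_closed)
  obtain C R where "usc_bounded_support F m C R"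
    unfolding F_def
    by (rule usc_bounded_support_compact[OF K(1) continuous_on_pnorm pnorm_nonneg, of p n m])
       (use p in auto)
  then interpret usc_bounded_support F m C R .
  have slice: "(\<integral>\<^sup>+x. F x \<partial>lborel_perp (Suc m) \<xi>) < ennreal b" if "\<xi> \<in> topspace (nsphere m)" for \<xi>
  proof -
    have "enn2real (\<integral>\<^sup>+x. F x \<partial>lborel_perp (Suc m) \<xi>) < b"
      using less[OF that] unfolding F_def n_def
      by (subst (asm) set_integral_perp_eq) (use that in \<open>simp_all add: pnorm_nonneg flip: n_def\<close>)
    moreover have "(\<integral>\<^sup>+x. F x \<partial>lborel_perp (Suc m) \<xi>) < \<infinity>"
      using slab_bounds(3)[OF that, of 1] by simp
    ultimately show ?thesis
      by (metis b ennreal_enn2real ennreal_less_iff enn2real_nonneg infinity_ennreal_def)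
  qed
  have \<epsilon>: "\<And>j. 0 < \<epsilon> j" "\<epsilon> \<longlonglongrightarrow> 0"
    unfolding \<epsilon>_def using LIMSEQ_Suc[OF lim_1_over_n] by auto
  \<comment> \<open>In dimension 1 the cyclic successor of 0 would be 0 itself;
    \<open>m \<ge> 1\<close> excludes this.\<close>
  have s: "s i < Suc m" "i \<noteq> s i" if "i < Suc m" for i
    using that \<open>m \<ge> 1\<close> by (auto simp: s_def)
  \<comment> \<open>Half the bound of \<open>sum_cyclic_max_ge\<close> for the entries
    \<open>\<bar>x i\<bar> + e\<close>; the shift keeps them positive where coordinates vanish, and
    the half matches the factor 2 in the denominators of the pair estimates.\<close>
  define q where "q e x = real n * (2 * (\<Sum>i<n. (\<bar>x i\<bar> + e) powr p) / real n) powr (- (1 / p)) / 2"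
    for e and x :: "nat \<Rightarrow> real"
  have [measurable]: "q e \<in> borel_measurable borel" for e
    unfolding q_def by measurable
  have "\<forall>\<^sub>F j in sequentially. \<forall>i\<in>{..<n}. (\<integral>\<^sup>+x. F x *
      ennreal (1 / (2 * (max \<bar>x i\<bar> \<bar>x (s i)\<bar> + \<epsilon> j))) \<partial>lborel_Rn (Suc m)) \<le> 6 * ennreal b"
    unfolding n_def
    using eventually_coordinate_pair_le[OF slice _ s(1,2) \<epsilon>] b
    by (intro eventually_ball_finite) auto
  then have ev: "\<forall>\<^sub>F j in sequentially. (\<integral>\<^sup>+x. F x * ennreal (q (\<epsilon> j) x) \<partial>lborel_Rn n)
      \<le> ennreal (6 * real n * b)"
  proof eventually_elim
    case (elim j)
    have "(\<integral>\<^sup>+x. F x * ennreal (q (\<epsilon> j) x) \<partial>lborel_Rn n)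
      \<le> (\<integral>\<^sup>+x. (\<Sum>i<n. F x * ennreal (1 / (2 * (max \<bar>x i\<bar> \<bar>x (s i)\<bar> + \<epsilon> j)))) \<partial>lborel_Rn n)"
    proof (rule nn_integral_mono)
      fix x :: "nat \<Rightarrow> real"
      have pos: "0 < max \<bar>x i\<bar> \<bar>x (s i)\<bar> + \<epsilon> j" for i
        using \<epsilon>(1)[of j] by (simp add: add_nonneg_pos le_max_iff_disj)
      have "2 * q (\<epsilon> j) x \<le> (\<Sum>i<n. 1 / max (\<bar>x i\<bar> + \<epsilon> j) (\<bar>x (s i)\<bar> + \<epsilon> j))"
        using sum_cyclic_max_ge[of m "\<lambda>i. \<bar>x i\<bar> + \<epsilon> j" p] p \<epsilon>(1)[of j]
        by (simp add: q_def n_def s_def add_nonneg_pos del: of_nat_Suc sum.lessThan_Suc)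
      also have "\<dots> = 2 * (\<Sum>i<n. 1 / (2 * (max \<bar>x i\<bar> \<bar>x (s i)\<bar> + \<epsilon> j)))"
        by (simp add: max_add_distrib_left sum_distrib_left)
      finally have "ennreal (q (\<epsilon> j) x) \<le> ennreal (\<Sum>i<n. 1 / (2 * (max \<bar>x i\<bar> \<bar>x (s i)\<bar> + \<epsilon> j)))"
        by (intro ennreal_leI) simp
      also have "\<dots> = (\<Sum>i<n. ennreal (1 / (2 * (max \<bar>x i\<bar> \<bar>x (s i)\<bar> + \<epsilon> j))))"
        using less_imp_le[OF pos]
        by (intro sum_ennreal[symmetric] divide_nonneg_nonneg mult_nonneg_nonneg) auto
      finally show "F x * ennreal (q (\<epsilon> j) x)
          \<le> (\<Sum>i<n. F x * ennreal (1 / (2 * (max \<bar>x i\<bar> \<bar>x (s i)\<bar> + \<epsilon> j))))"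
        unfolding sum_distrib_left[symmetric] by (intro mult_left_mono) auto
    qed
    also have "\<dots> = (\<Sum>i<n. \<integral>\<^sup>+x. F x * ennreal (1 / (2 * (max \<bar>x i\<bar> \<bar>x (s i)\<bar> + \<epsilon> j))) \<partial>lborel_Rn n)"
      by (intro nn_integral_sum) measurable
    also have "\<dots> \<le> (\<Sum>i<n. 6 * ennreal b)"
      using elim by (intro sum_mono) (simp add: n_def)
    also have "\<dots> = ennreal (6 * real n * b)"
      using b n by (simp add: ennreal_mult ennreal_of_nat_eq_real_of_nat mult_ac)
    finally show ?case .
  qed
  \<comment> \<open>The pointwise limit of \<open>F x * q (\<epsilon> j) x\<close> almost everywhere
    on \<open>K\<close>: the p-norm cancels against the negative power of the sum. Fatou then
    carries the bound \<open>ev\<close> over to \<open>d * V\<close>.\<close>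
  define d where "d = real n * (2 / real n) powr (- (1 / p)) / 2"
  have "ennreal d * ennreal V = (\<integral>\<^sup>+x. ennreal d * indicator K x \<partial>lborel_Rn n)"
    by (simp add: V nn_integral_cmult_indicator)
  also have "\<dots> \<le> (\<integral>\<^sup>+x. liminf (\<lambda>j. F x * ennreal (q (\<epsilon> j) x)) \<partial>lborel_Rn n)"
  proof (rule nn_integral_mono_AE)
    show "AE x in lborel_Rn n. ennreal d * indicator K x \<le> liminf (\<lambda>j. F x * ennreal (q (\<epsilon> j) x))"
      using AE_lborel_Rn_nonzero[of m] unfolding n_def[symmetric]
    proof eventually_elim
      case (elim x)
      define S where "S = (\<Sum>i<n. \<bar>x i\<bar> powr p)"
      have S: "0 < S"
        unfolding S_def using elim by (intro sum_pos2[of _ m]) (auto simp: n_def)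
      have "(\<lambda>j. \<Sum>i<n. (\<bar>x i\<bar> + \<epsilon> j) powr p) \<longlonglongrightarrow> (\<Sum>i<n. (\<bar>x i\<bar> + 0) powr p)"
        using p \<epsilon> by (intro tendsto_sum tendsto_powr' tendsto_intros)
          (auto intro!: always_eventually simp: add_nonneg_nonneg less_imp_le)
      then have lim: "(\<lambda>j. q (\<epsilon> j) x) \<longlonglongrightarrow> real n * (2 * S / real n) powr (- (1 / p)) / 2"
        unfolding q_def using S n
        by (intro tendsto_divide tendsto_mult tendsto_powr tendsto_const) (auto simp: S_def)
      have "(\<lambda>j. F x * ennreal (q (\<epsilon> j) x)) \<longlonglongrightarrow> F x * ennreal (real n * (2 * S / real n) powr (- (1 / p)) / 2)"
        by (intro ennreal_tendsto_cmult tendsto_ennrealI lim) (auto simp: F_def indicator_def)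
      then have "liminf (\<lambda>j. F x * ennreal (q (\<epsilon> j) x))
          = F x * ennreal (real n * (2 * S / real n) powr (- (1 / p)) / 2)"
        by (intro lim_imp_Liminf) auto
      also have "\<dots> = ennreal d * indicator K x"
      proof -
        have "(2 * S / real n) powr (- (1 / p)) = (2 / real n) powr (- (1 / p)) * S powr (- (1 / p))"
          using S n by (simp flip: powr_mult)
        then have "S powr (1 / p) * (real n * (2 * S / real n) powr (- (1 / p)) / 2)
            = d * (S powr (1 / p) * S powr (- (1 / p)))"
          by (simp add: d_def)
        also have "\<dots> = d" using S by (simp flip: powr_add)
        finally show ?thesis
          by (simp add: F_def pnorm_def indicator_def flip: S_def ennreal_mult)
      qed
      finally show ?case by simp
    qed
  qed
  also have "\<dots> \<le> liminf (\<lambda>j. \<integral>\<^sup>+x. F x * ennreal (q (\<epsilon> j) x) \<partial>lborel_Rn n)"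
    by (rule nn_integral_liminf) measurable
  also have "\<dots> \<le> limsup (\<lambda>j. \<integral>\<^sup>+x. F x * ennreal (q (\<epsilon> j) x) \<partial>lborel_Rn n)"
    by (rule Liminf_le_Limsup) simp
  also have "\<dots> \<le> ennreal (6 * real n * b)"
    using ev by (rule Limsup_bounded)
  finally have "ennreal (d * V) \<le> ennreal (6 * real n * b)"
    using V(1) by (subst ennreal_mult) (simp_all add: d_def)
  then have dV: "d * V \<le> 6 * real n * b"
    using n b by (subst (asm) ennreal_le_iff) auto
  \<comment> \<open>Since \<open>p \<ge> 1\<close>, the p-dependent factor is at least 1/2. This
    gives \<open>d \<ge> n * n powr (1 / p) / 4\<close>, whereas \<open>6 * n * b\<close> is
    \<open>n * n powr (1 / p) * V / 8\<close>.\<close>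
  have "2 powr (- (1 / p)) \<ge> 2 powr (- 1 :: real)"
    using p by (intro powr_mono) auto
  then have "(1 / 2) * real n powr (1 / p) \<le> 2 powr (- (1 / p)) * real n powr (1 / p)"
    by (intro mult_right_mono) (auto simp: powr_minus)
  also have "\<dots> = (2 / real n) powr (- (1 / p))"
    using n by (simp add: powr_divide powr_minus_divide field_simps)
  finally have "real n * ((1 / 2) * real n powr (1 / p)) / 2 * V \<le> d * V"
    unfolding d_def using n V by (intro mult_right_mono divide_right_mono mult_left_mono) auto
  then have "real n * (real n powr (1 / p) * V) * (1 / 4) \<le> real n * (real n powr (1 / p) * V) * (1 / 8)"
    using dV by (simp add: b_def algebra_simps)
  moreover have "0 < real n * (real n powr (1 / p) * V)"
    using n V by simp
  ultimately show False by linarith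
qed

theorem corollary5:
  fixes p :: real
  assumes "1 \<le> p" and "p \<le> 2"
  shows "\<exists>c>0. \<forall>n\<ge>2. \<forall>K.
    star_shaped_body n K \<and> origin_symmetric K \<longrightarrow>
      (\<exists>\<xi>\<in>topspace (nsphere (n - 1)).
        (LINT x:(K \<inter> perp n \<xi>)|lborel_perp n \<xi>. pnorm p n x)
          \<ge> c * real n powr (1 / p) * measure (lborel_Rn n) K)"
proof (intro exI[of _ "1 / 48 :: real"] conjI allI impI)
  fix n :: nat and K
  assume n: "2 \<le> n" and K: "star_shaped_body n K \<and> origin_symmetric K"
  then obtain m where m: "n = Suc m" "1 \<le> m" by (cases n) auto
  have "compact K"
    using K compactin_Euclidean_space_imp_compact by (auto simp: star_shaped_body_def)
  show "\<exists>\<xi>\<in>topspace (nsphere (n - 1)).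
      (LINT x:(K \<inter> perp n \<xi>)|lborel_perp n \<xi>. pnorm p n x)
        \<ge> 1 / 48 * real n powr (1 / p) * measure (lborel_Rn n) K"
  \<comment> \<open>With zero volume any point of the sphere works, since the section integral is
    nonnegative.\<close>
  proof (cases "measure (lborel_Rn n) K = 0")
    case True
    have "0 \<le> (LINT x:(K \<inter> perp n \<xi>)|lborel_perp n \<xi>. pnorm p n x)" for \<xi>
      unfolding set_lebesgue_integral_def by (intro integral_nonneg_AE) (simp add: pnorm_nonneg)
    then show ?thesis using True in_topspace_nsphere by auto
  next
    case False
    then show ?thesis
      using pnorm_slicing_inequality[OF assms(1) m(2) \<open>compact K\<close>] m by (simp add: zero_less_measure_iff)
  qed
qed simp

end
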